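(* Let $(M,g)$ be an oriented Riemannian $3$-manifold (not necessarily compact). Then the Cotton tensor of $g$ is divergence-free: $(d^\nabla)^*\mathfrak{Cott}(g)=0$.
   Context: $\nabla$ is the Levi-Civita connection of $g$, $R_{X,Y}=[\nabla_X,\nabla_Y]-\nabla_{[X,Y]}$ the curvature, $\mathfrak{Ric}(U,V)=\mathrm{tr}[X\mapsto R_{X,U}V]$ the Ricci tensor, $\mathfrak{scal}=\mathrm{tr}_g\mathfrak{Ric}$. The Schouten tensor is $\mathfrak{Sch}:=\mathfrak{Ric}-\frac{\mathfrak{scal}}{4}g$, viewed also as an endomorphism of $TM$ (a $TM$-valued $1$-form) via $g$. $d^\nabla$ is the extension of $\nabla$ to $TM$-valued forms, and the Cotton form is the $TM$-valued $2$-form $\mathfrak{cott}:=d^\nabla\mathfrak{Sch}$, i.e. $(d^\nabla\mathfrak{Sch})(X,Y)=(\nabla_X\mathfrak{Sch})(Y)-(\nabla_Y\mathfrak{Sch})(X)$. The Cotton tensor is the bilinear form $\mathfrak{Cott}(g):=*\,d^\nabla\mathfrak{Sch}$, with the Hodge star $*$ acting on the $2$-form part: for an oriented orthonormal frame $S_1,S_2,S_3$ and $(i,j,k)$ a cyclic permutation of $(1,2,3)$, $*(S^j\wedge S^k)=S^i$, so $\mathfrak{Cott}(S_i,Z)=\langle (d^\nabla\mathfrak{Sch})(S_j,S_k),Z\rangle$. $(d^\nabla)^*$ is the formal adjoint of $d^\nabla$; on a $2$-tensor $A$ (viewed as a $TM$-valued $1$-form) it is the divergence $(d^\nabla)^*A=-\sum_i(\nabla_{S_i}A)(S_i,\cdot)$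 for a local orthonormal frame $(S_i)$. *)

theory Defs
  imports "HOL-Analysis.Analysis" "HOL-Library.Function_Algebras"
begin

section \<open>Smooth maps on open subsets of normed spaces\<close>

text \<open>Only used with \<open>S\<close> open in a Euclidean space. There, a map all of whose iterated directional
  derivatives exist and are (Frechet) differentiable is the same as a \<open>C\<^sup>\<infinity>\<close> map.\<close>

primrec Ck_on ::
  "nat \<Rightarrow> 'a::real_normed_vector set \<Rightarrow> ('a \<Rightarrow> 'b::real_normed_vector) \<Rightarrow> bool" where
  "Ck_on 0 S f \<longleftrightarrow> continuous_on S f"
| "Ck_on (Suc k) S f \<longleftrightarrow>
     (\<forall>x\<in>S. f differentiable at x) \<and> (\<forall>v. Ck_on k S (\<lambda>x. frechet_derivative f (at x) v))"

definition smooth_on ::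
  "'a::real_normed_vector set \<Rightarrow> ('a \<Rightarrow> 'b::real_normed_vector) \<Rightarrow> bool" where
  "smooth_on S f \<longleftrightarrow> (\<forall>k. Ck_on k S f)"


section \<open>Oriented smooth 3-manifolds\<close>

text \<open>A chart is a pair \<open>(U, \<phi>)\<close> of a domain and a coordinate map, which is only relevant on \<open>U\<close>.\<close>

type_synonym 'a chart = "'a set \<times> ('a \<Rightarrow> real ^ 3)"

abbreviation dom_ch :: "'a chart \<Rightarrow> 'a set" where "dom_ch \<equiv> fst"

abbreviation coord :: "'a chart \<Rightarrow> 'a \<Rightarrow> real ^ 3" where "coord \<equiv> snd"

definition param :: "'a chart \<Rightarrow> real ^ 3 \<Rightarrow> 'a" where
  "param \<kappa> = inv_into (dom_ch \<kappa>) (coord \<kappa>)"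

definition is_chart :: "'a topology \<Rightarrow> 'a chart \<Rightarrow> bool" where
  "is_chart M \<kappa> \<longleftrightarrow>
     openin M (dom_ch \<kappa>) \<and> open (coord \<kappa> ` dom_ch \<kappa>) \<and>
     homeomorphic_map (subtopology M (dom_ch \<kappa>)) (top_of_set (coord \<kappa> ` dom_ch \<kappa>)) (coord \<kappa>)"

definition jac :: "'a chart \<Rightarrow> 'a chart \<Rightarrow> 'a \<Rightarrow> real ^ 3 \<Rightarrow> real ^ 3" where
  "jac \<kappa> \<kappa>' p = frechet_derivative (coord \<kappa>' \<circ> param \<kappa>) (at (coord \<kappa> p))"

definition oriented_smooth_3manifold :: "'a topology \<Rightarrow> 'a chart set \<Rightarrow> bool" where
  "oriented_smooth_3manifold M A \<longleftrightarrow>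
     Hausdorff_space M \<and> second_countable M \<and>
     (\<forall>\<kappa>\<in>A. is_chart M \<kappa>) \<and> (\<Union>\<kappa>\<in>A. dom_ch \<kappa>) = topspace M \<and>
     (\<forall>\<kappa>\<in>A. \<forall>\<kappa>'\<in>A. smooth_on (coord \<kappa> ` (dom_ch \<kappa> \<inter> dom_ch \<kappa>')) (coord \<kappa>' \<circ> param \<kappa>)) \<and>
     (\<forall>\<kappa>\<in>A. \<forall>\<kappa>'\<in>A. \<forall>p \<in> dom_ch \<kappa> \<inter> dom_ch \<kappa>'. det (matrix (jac \<kappa> \<kappa>' p)) > 0)"

definition chart_at :: "'a chart set \<Rightarrow> 'a \<Rightarrow> 'a chart" where
  "chart_at A p = (SOME \<kappa>. \<kappa> \<in> A \<and> p \<in> dom_ch \<kappa>)"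


section \<open>Tangent vectors, vector fields, functions\<close>

text \<open>A tangent vector at \<open>p\<close> is the family of its coordinate vectors in all charts around \<open>p\<close>,
  related by the Jacobians of the coordinate changes. The value at charts not around \<open>p\<close> is fixed
  to be 0, so that the tangent space is a 3-dimensional space under the pointwise operations.\<close>

type_synonym 'a tvec = "'a chart \<Rightarrow> real ^ 3"

type_synonym 'a vfield = "'a \<Rightarrow> 'a tvec"

definition tangent_space :: "'a chart set \<Rightarrow> 'a \<Rightarrow> 'a tvec set" where
  "tangent_space A p =
     {v. (\<forall>\<kappa>. \<not> (\<kappa> \<in> A \<and> p \<in> dom_ch \<kappa>) \<longrightarrow> v \<kappa> = 0) \<and>
         (\<forall>\<kappa>\<in>A. \<forall>\<kappa>'\<in>A. p \<in> dom_ch \<kappa> \<inter> dom_ch \<kappa>' \<longrightarrow> v \<kappa>' = jac \<kappa> \<kappa>' p (v \<kappa>))}"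

definition tscale :: "real \<Rightarrow> 'a tvec \<Rightarrow> 'a tvec" (infixr "\<odot>" 75) where
  "c \<odot> v = (\<lambda>\<kappa>. c *\<^sub>R v \<kappa>)"

text \<open>The tangent vector at \<open>p\<close> with coordinate vector \<open>u\<close> in the chart \<open>\<kappa>\<close>.\<close>

definition tvec_of :: "'a chart set \<Rightarrow> 'a \<Rightarrow> 'a chart \<Rightarrow> real ^ 3 \<Rightarrow> 'a tvec" where
  "tvec_of A p \<kappa> u = (\<lambda>\<kappa>'. if \<kappa>' \<in> A \<and> p \<in> dom_ch \<kappa>' then jac \<kappa> \<kappa>' p u else 0)"

definition smooth_fun :: "'a chart set \<Rightarrow> 'a set \<Rightarrow> ('a \<Rightarrow> real) \<Rightarrow> bool" where
  "smooth_fun A U f \<longleftrightarrow> (\<forall>\<kappa>\<in>A. smooth_on (coord \<kappa> ` (U \<inter> dom_ch \<kappa>)) (f \<circ> param \<kappa>))"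

definition smooth_vfield :: "'a chart set \<Rightarrow> 'a set \<Rightarrow> 'a vfield \<Rightarrow> bool" where
  "smooth_vfield A U Y \<longleftrightarrow>
     (\<forall>p\<in>U. Y p \<in> tangent_space A p) \<and>
     (\<forall>\<kappa>\<in>A. smooth_on (coord \<kappa> ` (U \<inter> dom_ch \<kappa>)) (\<lambda>x. Y (param \<kappa> x) \<kappa>))"

text \<open>The derivative \<open>v f\<close> of a function in the direction of a tangent vector at \<open>p\<close>
  (independent of the chart).\<close>

definition tderiv :: "'a chart set \<Rightarrow> 'a \<Rightarrow> 'a tvec \<Rightarrow> ('a \<Rightarrow> real) \<Rightarrow> real" where
  "tderiv A p v f =
     (let \<kappa> = chart_at A p in frechet_derivative (f \<circ> param \<kappa>) (at (coord \<kappa> p)) (v \<kappa>))"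

text \<open>In coordinates \<open>[X, Y]\<^sup>i = \<Sum>\<^sub>j (X\<^sup>j \<partial>\<^sub>j Y\<^sup>i - Y\<^sup>j \<partial>\<^sub>j X\<^sup>i)\<close>, i.e. \<open>[X, Y] f = X (Y f) - Y (X f)\<close>.\<close>

definition lie_bracket :: "'a chart set \<Rightarrow> 'a vfield \<Rightarrow> 'a vfield \<Rightarrow> 'a vfield" where
  "lie_bracket A X Y = (\<lambda>p \<kappa>. if \<kappa> \<in> A \<and> p \<in> dom_ch \<kappa>
     then frechet_derivative (\<lambda>x. Y (param \<kappa> x) \<kappa>) (at (coord \<kappa> p)) (X p \<kappa>)
        - frechet_derivative (\<lambda>x. X (param \<kappa> x) \<kappa>) (at (coord \<kappa> p)) (Y p \<kappa>)
     else 0)"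

text \<open>An extension of a tangent vector \<open>v\<close> at \<open>p\<close> to a smooth vector field near \<open>p\<close> (with constant
  coefficients in a chart). It is only used to evaluate expressions that are tensorial, so
  that the value at \<open>p\<close> does not depend on the extension.\<close>

definition ext :: "'a chart set \<Rightarrow> 'a \<Rightarrow> 'a tvec \<Rightarrow> 'a vfield" where
  "ext A p v = (\<lambda>q. tvec_of A q (chart_at A p) (v (chart_at A p)))"


section \<open>Riemannian metrics and the Levi-Civita connection\<close>

type_synonym 'a bilin = "'a \<Rightarrow> 'a tvec \<Rightarrow> 'a tvec \<Rightarrow> real"

definition riemannian_metric :: "'a topology \<Rightarrow> 'a chart set \<Rightarrow> 'a bilin \<Rightarrow> bool" where
  "riemannian_metric M A g \<longleftrightarrow>
     (\<forall>p \<in> topspace M. \<forall>u \<in> tangent_space A p. \<forall>v \<in> tangent_space A p.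
        g p u v = g p v u \<and>
        (u \<noteq> 0 \<longrightarrow> g p u u > 0) \<and>
        (\<forall>w \<in> tangent_space A p. g p (u + v) w = g p u w + g p v w) \<and>
        (\<forall>c. g p (c \<odot> u) v = c * g p u v)) \<and>
     (\<forall>U Y Z. openin M U \<and> smooth_vfield A U Y \<and> smooth_vfield A U Z \<longrightarrow>
        smooth_fun A U (\<lambda>p. g p (Y p) (Z p)))"

text \<open>Connections are local operators, and are here applied to vector fields on arbitrary open
  sets \<open>U\<close> (such as local frames). Compatibility with restriction to smaller open sets need not be
  stated separately: the operator does not depend on \<open>U\<close>, and the rules for products with functions
  that are 1 on \<open>U\<close> show that the values on \<open>U\<close> only depend on the values of the arguments on \<open>U\<close>.\<close>

type_synonym 'a conn = "'a vfield \<Rightarrow> 'a vfield \<Rightarrow> 'a vfield"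

definition affine_connection :: "'a topology \<Rightarrow> 'a chart set \<Rightarrow> 'a conn \<Rightarrow> bool" where
  "affine_connection M A nabla \<longleftrightarrow>
     (\<forall>U Y Z. openin M U \<and> smooth_vfield A U Y \<and> smooth_vfield A U Z \<longrightarrow>
        smooth_vfield A U (nabla Y Z) \<and>
        (\<forall>W p. smooth_vfield A U W \<and> p \<in> U \<longrightarrow>
           nabla (Y + W) Z p = nabla Y Z p + nabla W Z p \<and>
           nabla Y (Z + W) p = nabla Y Z p + nabla Y W p) \<and>
        (\<forall>f p. smooth_fun A U f \<and> p \<in> U \<longrightarrow>
           nabla (\<lambda>q. f q \<odot> Y q) Z p = f p \<odot> nabla Y Z p \<and>
           nabla Y (\<lambda>q. f q \<odot> Z q) p = tderiv A p (Y p) f \<odot> Z p + f p \<odot> nabla Y Z p))"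

definition levi_civita ::
  "'a topology \<Rightarrow> 'a chart set \<Rightarrow> 'a bilin \<Rightarrow> 'a conn \<Rightarrow> bool" where
  "levi_civita M A g nabla \<longleftrightarrow>
     affine_connection M A nabla \<and>
     (\<forall>U X Y p. openin M U \<and> smooth_vfield A U X \<and> smooth_vfield A U Y \<and> p \<in> U \<longrightarrow>
        nabla X Y p - nabla Y X p = lie_bracket A X Y p) \<and>
     (\<forall>U X Y Z p. openin M U \<and> smooth_vfield A U X \<and> smooth_vfield A U Y \<and> smooth_vfield A U Z
        \<and> p \<in> U \<longrightarrow>
        tderiv A p (X p) (\<lambda>q. g q (Y q) (Z q)) = g p (nabla X Y p) (Z p) + g p (Y p) (nabla X Z p))"


section \<open>Curvature, Ricci, scalar and Schouten tensors\<close>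

definition curvature ::
  "'a chart set \<Rightarrow> 'a conn \<Rightarrow> 'a vfield \<Rightarrow> 'a vfield \<Rightarrow> 'a vfield \<Rightarrow> 'a vfield" where
  "curvature A nabla X Y Z =
     nabla X (nabla Y Z) - nabla Y (nabla X Z) - nabla (lie_bracket A X Y) Z"

text \<open>The trace of an endomorphism of the tangent space at \<open>p\<close>, computed in coordinates.\<close>

definition tangent_trace :: "'a chart set \<Rightarrow> 'a \<Rightarrow> ('a tvec \<Rightarrow> 'a tvec) \<Rightarrow> real" where
  "tangent_trace A p L =
     (let \<kappa> = chart_at A p in trace (matrix (\<lambda>u. L (tvec_of A p \<kappa> u) \<kappa>)))"

text \<open>The endomorphism of the tangent space corresponding to a bilinear form via \<open>g\<close>.\<close>

definition endo_of ::
  "'a chart set \<Rightarrow> 'a bilin \<Rightarrow> 'a bilin \<Rightarrow> 'a \<Rightarrow> 'a tvec \<Rightarrow> 'a tvec" where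
  "endo_of A g B p u =
     (THE w. w \<in> tangent_space A p \<and> (\<forall>v \<in> tangent_space A p. g p w v = B p u v))"

definition ricci :: "'a chart set \<Rightarrow> 'a conn \<Rightarrow> 'a bilin" where
  "ricci A nabla p u v =
     tangent_trace A p (\<lambda>x. curvature A nabla (ext A p x) (ext A p u) (ext A p v) p)"

definition scal :: "'a chart set \<Rightarrow> 'a bilin \<Rightarrow> 'a conn \<Rightarrow> 'a \<Rightarrow> real" where
  "scal A g nabla p = tangent_trace A p (endo_of A g (ricci A nabla) p)"

definition schouten :: "'a chart set \<Rightarrow> 'a bilin \<Rightarrow> 'a conn \<Rightarrow> 'a bilin" where
  "schouten A g nabla p u v = ricci A nabla p u v - scal A g nabla p / 4 * g p u v"

definition schouten_endo ::
  "'a chart set \<Rightarrow> 'a bilin \<Rightarrow> 'a conn \<Rightarrow> 'a \<Rightarrow> 'a tvec \<Rightarrow> 'a tvec" where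
  "schouten_endo A g nabla = endo_of A g (schouten A g nabla)"


section \<open>The Cotton form and the Cotton tensor\<close>

text \<open>\<open>covd_endo nabla F X Y\<close> is \<open>(\<nabla>\<^sub>X F)(Y)\<close> for a field \<open>F\<close> of endomorphisms of the tangent bundle,
  and \<open>ext_covd nabla F X Y\<close> is \<open>(d\<^sup>\<nabla> F)(X, Y)\<close>.\<close>

definition covd_endo ::
  "'a conn \<Rightarrow> ('a \<Rightarrow> 'a tvec \<Rightarrow> 'a tvec) \<Rightarrow> 'a vfield \<Rightarrow> 'a vfield \<Rightarrow> 'a vfield" where
  "covd_endo nabla F X Y = nabla X (\<lambda>q. F q (Y q)) - (\<lambda>q. F q (nabla X Y q))"

definition ext_covd ::
  "'a conn \<Rightarrow> ('a \<Rightarrow> 'a tvec \<Rightarrow> 'a tvec) \<Rightarrow> 'a vfield \<Rightarrow> 'a vfield \<Rightarrow> 'a vfield" where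
  "ext_covd nabla F X Y = covd_endo nabla F X Y - covd_endo nabla F Y X"

definition cotton_form ::
  "'a chart set \<Rightarrow> 'a bilin \<Rightarrow> 'a conn \<Rightarrow> 'a \<Rightarrow> 'a tvec \<Rightarrow> 'a tvec \<Rightarrow> 'a tvec" where
  "cotton_form A g nabla p x y =
     ext_covd nabla (schouten_endo A g nabla) (ext A p x) (ext A p y) p"

definition orthonormal_basis_at ::
  "'a chart set \<Rightarrow> 'a bilin \<Rightarrow> 'a \<Rightarrow> (3 \<Rightarrow> 'a tvec) \<Rightarrow> bool" where
  "orthonormal_basis_at A g p S \<longleftrightarrow>
     (\<forall>i. S i \<in> tangent_space A p) \<and> (\<forall>i j. g p (S i) (S j) = (if i = j then 1 else 0))"

definition positively_oriented_at :: "'a chart set \<Rightarrow> 'a \<Rightarrow> (3 \<Rightarrow> 'a tvec) \<Rightarrow> bool" where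
  "positively_oriented_at A p S \<longleftrightarrow>
     (\<forall>\<kappa>\<in>A. p \<in> dom_ch \<kappa> \<longrightarrow> det (\<chi> i. S i \<kappa>) > 0)"

text \<open>The Hodge star on the form part of a tangent-vector-valued 2-form \<open>\<beta>\<close>:
  writing \<open>\<beta> = \<Sum> (S\<^sup>j \<and> S\<^sup>k) \<otimes> \<beta>(S\<^sub>j, S\<^sub>k)\<close> over cyclic \<open>(i, j, k)\<close>, one has
  \<open>*\<beta> = \<Sum> S\<^sup>i \<otimes> \<beta>(S\<^sub>j, S\<^sub>k)\<close>. Arithmetic in the index type \<open>3\<close> is modulo 3, so the cyclic
  permutations of \<open>(1, 2, 3)\<close> are the triples \<open>(i, i + 1, i + 2)\<close>. The value does not depend on the
  positively oriented orthonormal basis.\<close>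

definition hodge_star ::
  "'a chart set \<Rightarrow> 'a bilin \<Rightarrow> ('a \<Rightarrow> 'a tvec \<Rightarrow> 'a tvec \<Rightarrow> 'a tvec) \<Rightarrow> 'a \<Rightarrow> 'a tvec \<Rightarrow> 'a tvec" where
  "hodge_star A g \<beta> p x =
     (let S = (SOME S. orthonormal_basis_at A g p S \<and> positively_oriented_at A p S)
      in \<Sum>i\<in>UNIV. g p x (S i) \<odot> \<beta> p (S (i + 1)) (S (i + 2)))"

definition cotton :: "'a chart set \<Rightarrow> 'a bilin \<Rightarrow> 'a conn \<Rightarrow> 'a bilin" where
  "cotton A g nabla p x z = g p (hodge_star A g (cotton_form A g nabla) p x) z"


section \<open>Divergence of 2-tensors\<close>

text \<open>\<open>covd_bilin A nabla B X Y Z p\<close> is \<open>(\<nabla>\<^sub>X B)(Y, Z)\<close> at \<open>p\<close>.\<close>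

definition covd_bilin ::
  "'a chart set \<Rightarrow> 'a conn \<Rightarrow> 'a bilin \<Rightarrow> 'a vfield \<Rightarrow> 'a vfield \<Rightarrow> 'a vfield \<Rightarrow> 'a \<Rightarrow> real" where
  "covd_bilin A nabla B X Y Z p =
     tderiv A p (X p) (\<lambda>q. B q (Y q) (Z q)) - B p (nabla X Y p) (Z p) - B p (Y p) (nabla X Z p)"

text \<open>\<open>(d\<^sup>\<nabla>)\<^sup>* B = - \<Sum>\<^sub>i (\<nabla>\<^bsub>S\<^sub>i\<^esub> B)(S\<^sub>i, \<cdot>)\<close>, evaluated at a tangent vector \<open>z\<close> at \<open>p\<close>. As \<open>\<nabla> B\<close> is a tensor,
  only the orthonormal basis at \<open>p\<close> given by a local frame matters.\<close>

definition codiff :: "'a chart set \<Rightarrow> 'a bilin \<Rightarrow> 'a conn \<Rightarrow> 'a bilin \<Rightarrow> 'a \<Rightarrow> 'a tvec \<Rightarrow> real" where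
  "codiff A g nabla B p z =
     (let S = (SOME S. orthonormal_basis_at A g p S)
      in - (\<Sum>i\<in>UNIV. covd_bilin A nabla B (ext A p (S i)) (ext A p (S i)) (ext A p z) p))"

end

theory Submission
  imports Defs
begin

text \<open>
  The idea. Write \<open>P\<close> for the Schouten endomorphism, so that the Cotton form is \<open>d\<^sup>\<nabla> P\<close>. As \<open>*\<close> is
  parallel, the divergence of \<open>* d\<^sup>\<nabla> P\<close> is, up to sign, \<open>* d\<^sup>\<nabla> d\<^sup>\<nabla> P\<close>, and \<open>d\<^sup>\<nabla> d\<^sup>\<nabla>\<close> is the action of the
  curvature: what has to vanish is the cyclic sum of \<open>R\<^bsub>X,Y\<^esub> (P Z)\<close>. This is algebra. In dimension three
  the curvature at a point is determined by the Ricci tensor, and in an orthonormal basis \<open>S\<close> in which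
  the latter is diagonal all vectors \<open>R\<^bsub>S\<^sub>i,S\<^sub>j\<^esub> S\<^sub>k\<close> with \<open>i, j, k\<close> distinct vanish; \<open>P\<close> is diagonal in the
  same basis, so the sum is zero (\<open>curvature_ricci_cyclic\<close>). The scalar curvature part of \<open>P\<close>
  contributes a multiple of the cyclic sum in the first Bianchi identity.

  The analysis takes place in one chart, on an open set \<open>V\<close> of three-space, with the metric \<open>G\<close> and the
  Christoffel symbols \<open>\<Gamma>\<close> as data. Smooth orthonormal frames are avoided by the formula
  \<open>*\<beta> (u) = (det G)\<^bsup>-1/2\<^esup> \<Sum>\<^sub>c G(u, E\<^sub>c) \<beta> (E\<^sub>c\<^sub>+\<^sub>1, E\<^sub>c\<^sub>+\<^sub>2)\<close> in the coordinate frame \<open>E\<close>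
  (\<open>hodge_standard_basis\<close>). In the divergence of this expression the derivative of the density
  \<open>(det G)\<^bsup>-1/2\<^esup>\<close> cancels against the divergence of the fields \<open>E\<^sub>c\<close> (\<open>has_derivative_density\<close>), which is
  the parallelism of \<open>*\<close> in these terms, and the rest is \<open>d\<^sup>\<nabla> d\<^sup>\<nabla> P\<close> evaluated on commuting fields
  (\<open>exterior_derivative_Cott_form\<close>). Together these give \<open>divergence_Cott\<close>.

  Finally every tensor on the manifold has to be identified with its coordinate expression. The
  obstacle is that the tensors at a point \<open>q\<close> are defined by extending vectors in a chart chosen for \<open>q\<close>,
  which varies with \<open>q\<close>; so curvature and Cotton form must be shown to be tensorial, on fields with
  arbitrary coefficients (\<open>curvature_tensorial\<close>, \<open>Cott_form_tensorial\<close>). The connection is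
  \<open>\<partial> + \<Gamma>\<close> in a chart (\<open>nabla_coords\<close>) because it is local (\<open>nabla_cong\<close>).
\<close>


section \<open>Calculus of smooth maps\<close>

abbreviation dderiv :: "('a::real_normed_vector \<Rightarrow> 'b::real_normed_vector) \<Rightarrow> 'a \<Rightarrow> 'a \<Rightarrow> 'b" where
  "dderiv f x v \<equiv> frechet_derivative f (at x) v"

lemma dderiv_eqI: "(f has_derivative f') (at x) \<Longrightarrow> dderiv f x v = f' v"
  using frechet_derivative_at by metis

lemma has_derivative_dderiv: "f differentiable at x \<Longrightarrow> (f has_derivative dderiv f x) (at x)"
  using frechet_derivative_works by blast

lemma dderiv_cong_open:
  assumes "open S" "x \<in> S" "\<And>y. y \<in> S \<Longrightarrow> f y = g y"
  shows "dderiv f x = dderiv g x"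
proof -
  have "(f has_derivative F) (at x) \<longleftrightarrow> (g has_derivative F) (at x)" for F
    using has_derivative_transform_within_open[OF _ assms(1,2)] assms(3) by metis
  then show ?thesis by (simp add: frechet_derivative_def)
qed

lemma differentiable_cong_open:
  assumes "f differentiable at x" "open S" "x \<in> S" "\<And>y. y \<in> S \<Longrightarrow> f y = g y"
  shows "g differentiable at x"
  using assms has_derivative_transform_within_open unfolding differentiable_def by blast

lemma Ck_on_cong:
  assumes "open S" "\<And>x. x \<in> S \<Longrightarrow> f x = g x" "Ck_on k S f"
  shows "Ck_on k S g"
  using assms(2,3)
proof (induction k arbitrary: f g)
  case 0
  then show ?case using continuous_on_cong by (metis Ck_on.simps(1))
next
  case (Suc k)
  have "dderiv f x v = dderiv g x v" if "x \<in> S" for x v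
    using dderiv_cong_open[OF assms(1) that, of f g] Suc.prems by simp
  then have "Ck_on k S (\<lambda>x. dderiv g x v)" for v
    using Suc.IH[of "\<lambda>x. dderiv f x v" "\<lambda>x. dderiv g x v"] Suc.prems(2) by simp
  moreover have "g differentiable at x" if "x \<in> S" for x
    using differentiable_cong_open[OF _ assms(1) that, of f g] Suc.prems that by simp
  ultimately show ?case by simp
qed

lemma Ck_on_SucD: "Ck_on (Suc k) S f \<Longrightarrow> Ck_on k S f"
proof (induction k arbitrary: f)
  case 0
  then show ?case
    by (auto intro!: continuous_at_imp_continuous_on differentiable_imp_continuous_within)
next
  case (Suc k)
  then show ?case by (metis Ck_on.simps(2))
qed

lemma Ck_on_subset: "Ck_on k S f \<Longrightarrow> T \<subseteq> S \<Longrightarrow> Ck_on k T f"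
  by (induction k arbitrary: f) (auto intro: continuous_on_subset)

lemma Ck_on_const: "Ck_on k S (\<lambda>x. c)"
  by (induction k arbitrary: c) auto

lemma Ck_on_add:
  assumes "open S" "Ck_on k S f" "Ck_on k S g"
  shows "Ck_on k S (\<lambda>x. f x + g x)"
  using assms(2,3)
proof (induction k arbitrary: f g)
  case 0
  then show ?case by (auto intro: continuous_intros)
next
  case (Suc k)
  have eq: "dderiv f x v + dderiv g x v = dderiv (\<lambda>x. f x + g x) x v" if "x \<in> S" for x v
    using Suc.prems that
    by (intro dderiv_eqI[symmetric] has_derivative_add has_derivative_dderiv) auto
  have "Ck_on k S (\<lambda>x. dderiv (\<lambda>x. f x + g x) x v)" for v
    by (rule Ck_on_cong[OF assms(1) eq]) (use Suc in auto)
  then show ?case using Suc.prems by auto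
qed

lemma (in bounded_linear) Ck_on_image:
  assumes "open S" "Ck_on k S u"
  shows "Ck_on k S (\<lambda>x. f (u x))"
  using assms(2)
proof (induction k arbitrary: u)
  case 0
  then show ?case by (auto intro: continuous_on)
next
  case (Suc k)
  have der: "((\<lambda>x. f (u x)) has_derivative (\<lambda>v. f (dderiv u x v))) (at x)" if "x \<in> S" for x
    using Suc.prems that by (intro has_derivative has_derivative_dderiv) auto
  have "Ck_on k S (\<lambda>x. dderiv (\<lambda>x. f (u x)) x v)" for v
    by (rule Ck_on_cong[OF assms(1) dderiv_eqI[OF der, symmetric]]) (use Suc in auto)
  then show ?case using der by (auto simp: differentiable_def)
qed

lemma (in bounded_bilinear) Ck_on_prod:
  assumes "open S" "Ck_on k S f" "Ck_on k S g"
  shows "Ck_on k S (\<lambda>x. prod (f x) (g x))"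
  using assms(2,3)
proof (induction k arbitrary: f g)
  case 0
  then show ?case by (auto intro: continuous_on)
next
  case (Suc k)
  have der: "((\<lambda>x. prod (f x) (g x)) has_derivative
      (\<lambda>v. prod (f x) (dderiv g x v) + prod (dderiv f x v) (g x))) (at x)" if "x \<in> S" for x
    using Suc.prems that by (intro FDERIV has_derivative_dderiv) auto
  have "Ck_on k S f" "Ck_on k S g" "Ck_on k S (\<lambda>x. dderiv f x v)" "Ck_on k S (\<lambda>x. dderiv g x v)" for v
    using Suc.prems Ck_on_SucD by (blast, blast, auto)
  then have "Ck_on k S (\<lambda>x. prod (f x) (dderiv g x v) + prod (dderiv f x v) (g x))" for v
    by (intro Ck_on_add assms(1) Suc.IH)
  then have "Ck_on k S (\<lambda>x. dderiv (\<lambda>x. prod (f x) (g x)) x v)" for v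
    by (rule Ck_on_cong[OF assms(1) dderiv_eqI[OF der, symmetric], rotated])
  then show ?case using der by (auto simp: differentiable_def)
qed

lemma Ck_on_inverse:
  fixes f :: "'a::real_normed_vector \<Rightarrow> real"
  assumes "open S" "Ck_on k S f" "\<And>x. x \<in> S \<Longrightarrow> f x \<noteq> 0"
  shows "Ck_on k S (\<lambda>x. inverse (f x))"
  using assms(2)
proof (induction k)
  case 0
  then show ?case using assms(3) by (auto intro: continuous_intros)
next
  case (Suc k)
  have der: "((\<lambda>x. inverse (f x)) has_derivative
      (\<lambda>v. - (inverse (f x) * dderiv f x v * inverse (f x)))) (at x)" if "x \<in> S" for x
    using Suc.prems that assms(3) by (intro Deriv.has_derivative_inverse has_derivative_dderiv) auto
  have inv: "Ck_on k S (\<lambda>x. inverse (f x))" using Suc Ck_on_SucD by blast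
  have "Ck_on k S (\<lambda>x. - (inverse (f x) * dderiv f x v * inverse (f x)))" for v
    by (intro bounded_linear.Ck_on_image[OF bounded_linear_minus[OF bounded_linear_ident]]
        bounded_bilinear.Ck_on_prod[OF bounded_bilinear_mult] assms(1) inv)
      (use Suc.prems in auto)
  then have "Ck_on k S (\<lambda>x. dderiv (\<lambda>x. inverse (f x)) x v)" for v
    by (intro Ck_on_cong[OF assms(1) dderiv_eqI[OF der, symmetric]])
  then show ?case using der by (auto simp: differentiable_def)
qed

lemma Ck_on_sum:
  assumes "open S" "finite I" "\<And>i. i \<in> I \<Longrightarrow> Ck_on k S (f i)"
  shows "Ck_on k S (\<lambda>x. \<Sum>i\<in>I. f i x)"
  using assms(2,3) by (induction I) (auto intro: Ck_on_const Ck_on_add assms(1))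

text \<open>The chain rule gives the derivative of a composite as a sum of products of functions that
  are again composites or derivatives, which is why the order of differentiability is preserved.\<close>

lemma Ck_on_compose:
  fixes h :: "'a::real_normed_vector \<Rightarrow> 'b::euclidean_space"
  assumes "open S" "open T" "h ` S \<subseteq> T" "Ck_on k S h" "Ck_on k T f"
  shows "Ck_on k S (\<lambda>x. f (h x))"
  using assms(4,5)
proof (induction k arbitrary: f)
  case 0
  then show ?case using assms(3) by (auto intro: continuous_on_compose2)
next
  case (Suc k)
  have der: "((\<lambda>x. f (h x)) has_derivative (\<lambda>v. dderiv f (h x) (dderiv h x v))) (at x)"
    if "x \<in> S" for x
    using Suc.prems that assms(3)
    by (intro has_derivative_compose[where f=h, OF has_derivative_dderiv has_derivative_dderiv]) auto
  have lin: "linear (dderiv f (h x))" if "x \<in> S" for x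
    using Suc.prems that assms(3) by (intro linear_frechet_derivative) auto
  have eq: "(\<Sum>b\<in>Basis. (dderiv h x v \<bullet> b) *\<^sub>R dderiv f (h x) b) = dderiv (\<lambda>x. f (h x)) x v"
    if "x \<in> S" for x v
  proof -
    have "dderiv f (h x) (dderiv h x v) = dderiv f (h x) (\<Sum>b\<in>Basis. (dderiv h x v \<bullet> b) *\<^sub>R b)"
      by (simp only: euclidean_representation)
    also have "\<dots> = (\<Sum>b\<in>Basis. (dderiv h x v \<bullet> b) *\<^sub>R dderiv f (h x) b)"
      by (simp only: linear_sum[OF lin[OF that]] linear_cmul[OF lin[OF that]])
    finally show ?thesis using dderiv_eqI[OF der[OF that]] by metis
  qed
  have "Ck_on k S (\<lambda>x. \<Sum>b\<in>Basis. (dderiv h x v \<bullet> b) *\<^sub>R dderiv f (h x) b)" for v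
    by (intro Ck_on_sum bounded_bilinear.Ck_on_prod[OF bounded_bilinear_scaleR] assms(1)
        bounded_linear.Ck_on_image[OF bounded_linear_inner_left] Suc.IH)
      (use Suc.prems Ck_on_SucD in auto)
  then have "Ck_on k S (\<lambda>x. dderiv (\<lambda>x. f (h x)) x v)" for v
    by (intro Ck_on_cong[OF assms(1) eq])
  then show ?case using der by (auto simp: differentiable_def)
qed

lemma smooth_on_cong: "open S \<Longrightarrow> smooth_on S f \<Longrightarrow> (\<And>x. x \<in> S \<Longrightarrow> f x = g x) \<Longrightarrow> smooth_on S g"
  unfolding smooth_on_def using Ck_on_cong by blast

lemma smooth_on_subset: "smooth_on S f \<Longrightarrow> T \<subseteq> S \<Longrightarrow> smooth_on T f"
  unfolding smooth_on_def using Ck_on_subset by blast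

lemma smooth_on_differentiable: "smooth_on S f \<Longrightarrow> x \<in> S \<Longrightarrow> f differentiable at x"
  unfolding smooth_on_def by (metis Ck_on.simps(2))

lemma smooth_on_has_derivative:
  "smooth_on S f \<Longrightarrow> x \<in> S \<Longrightarrow> (f has_derivative dderiv f x) (at x)"
  by (simp add: has_derivative_dderiv smooth_on_differentiable)

lemma smooth_on_dderiv: "smooth_on S f \<Longrightarrow> smooth_on S (\<lambda>x. dderiv f x v)"
  unfolding smooth_on_def by (metis Ck_on.simps(2))

lemma smooth_on_const: "smooth_on S (\<lambda>x. c)"
  by (simp add: smooth_on_def Ck_on_const)

lemma smooth_on_add: "open S \<Longrightarrow> smooth_on S f \<Longrightarrow> smooth_on S g \<Longrightarrow> smooth_on S (\<lambda>x. f x + g x)"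
  by (simp add: smooth_on_def Ck_on_add)

lemma smooth_on_scaleR:
  "open S \<Longrightarrow> smooth_on S f \<Longrightarrow> smooth_on S g \<Longrightarrow> smooth_on S (\<lambda>x. f x *\<^sub>R g x)"
  by (simp add: smooth_on_def bounded_bilinear.Ck_on_prod[OF bounded_bilinear_scaleR])

lemma smooth_on_mult:
  fixes f g :: "'a::real_normed_vector \<Rightarrow> real"
  shows "open S \<Longrightarrow> smooth_on S f \<Longrightarrow> smooth_on S g \<Longrightarrow> smooth_on S (\<lambda>x. f x * g x)"
  by (simp add: smooth_on_def bounded_bilinear.Ck_on_prod[OF bounded_bilinear_mult])

lemma smooth_on_linear:
  "bounded_linear L \<Longrightarrow> open S \<Longrightarrow> smooth_on S f \<Longrightarrow> smooth_on S (\<lambda>x. L (f x))"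
  by (simp add: smooth_on_def bounded_linear.Ck_on_image)

lemma smooth_on_diff:
  assumes "open S" "smooth_on S f" "smooth_on S g"
  shows "smooth_on S (\<lambda>x. f x - g x)"
  using smooth_on_add[OF assms(1,2)
      smooth_on_linear[OF bounded_linear_minus[OF bounded_linear_ident] assms(1,3)]] by simp

lemma smooth_on_divide:
  fixes f g :: "'a::real_normed_vector \<Rightarrow> real"
  assumes "open S" "smooth_on S f" "smooth_on S g" "\<And>x. x \<in> S \<Longrightarrow> g x \<noteq> 0"
  shows "smooth_on S (\<lambda>x. f x / g x)"
  using assms unfolding divide_inverse smooth_on_def
  by (intro allI bounded_bilinear.Ck_on_prod[OF bounded_bilinear_mult] Ck_on_inverse) auto

lemma smooth_on_sum:
  "open S \<Longrightarrow> finite I \<Longrightarrow> (\<And>i. i \<in> I \<Longrightarrow> smooth_on S (f i)) \<Longrightarrow> smooth_on S (\<lambda>x. \<Sum>i\<in>I. f i x)"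
  by (simp add: smooth_on_def Ck_on_sum)

lemma smooth_on_compose:
  fixes h :: "'a::real_normed_vector \<Rightarrow> 'b::euclidean_space"
  shows "open S \<Longrightarrow> open T \<Longrightarrow> h ` S \<subseteq> T \<Longrightarrow> smooth_on S h \<Longrightarrow> smooth_on T f \<Longrightarrow> smooth_on S (\<lambda>x. f (h x))"
  by (simp add: smooth_on_def Ck_on_compose)

lemma smooth_on_nth:
  fixes f :: "'a::real_normed_vector \<Rightarrow> real ^ 'n"
  shows "open S \<Longrightarrow> smooth_on S f \<Longrightarrow> smooth_on S (\<lambda>x. f x $ i)"
  by (rule smooth_on_linear[OF bounded_linear_vec_nth])

lemma vec_expansion: "(u :: real ^ 'n) = (\<Sum>i\<in>UNIV. u $ i *\<^sub>R axis i 1)"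
  using basis_expansion[of u] by (simp add: scalar_mult_eq_scaleR)

lemma smooth_on_vec:
  fixes f :: "'a::real_normed_vector \<Rightarrow> real ^ 'n"
  assumes "open S" "\<And>i. smooth_on S (\<lambda>x. f x $ i)"
  shows "smooth_on S f"
proof (rule smooth_on_cong[OF assms(1)])
  show "smooth_on S (\<lambda>x. \<Sum>i\<in>UNIV. f x $ i *\<^sub>R axis i (1::real))"
    using assms by (intro smooth_on_sum smooth_on_scaleR smooth_on_const) auto
qed (rule vec_expansion[symmetric])

section \<open>Symmetry of second derivatives\<close>

text \<open>The mean value theorem twice, first along \<open>u\<close> and then along \<open>v\<close>, for the second difference of \<open>f\<close>
over a small parallelogram. That difference is symmetric in \<open>u\<close> and \<open>v\<close>, the right-hand side is not
visibly so.\<close>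

lemma second_difference_mean_value:
  fixes f :: "'a::real_normed_vector \<Rightarrow> real"
  assumes "smooth_on S f" "h > 0"
    and in_S: "\<And>s t. 0 \<le> s \<Longrightarrow> s \<le> h \<Longrightarrow> 0 \<le> t \<Longrightarrow> t \<le> h \<Longrightarrow> x + s *\<^sub>R u + t *\<^sub>R v \<in> S"
  obtains s t where "0 < s" "s < h" "0 < t" "t < h"
    "f (x + h *\<^sub>R u + h *\<^sub>R v) - f (x + h *\<^sub>R u) - f (x + h *\<^sub>R v) + f x
      = h * h * dderiv (\<lambda>y. dderiv f y u) (x + s *\<^sub>R u + t *\<^sub>R v) v"
proof -
  have line: "((\<lambda>s. F (a + s *\<^sub>R w)) has_real_derivative dderiv F (a + s *\<^sub>R w) w) (at s)"
    if "smooth_on S F" "a + s *\<^sub>R w \<in> S" for F :: "'a \<Rightarrow> real" and a s w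
  proof -
    have lin: "linear (dderiv F (a + s *\<^sub>R w))"
      using that smooth_on_differentiable linear_frechet_derivative by blast
    have "((\<lambda>s. a + s *\<^sub>R w) has_derivative (\<lambda>k. k *\<^sub>R w)) (at s)"
      by (auto intro!: derivative_eq_intros)
    from has_derivative_compose[OF this smooth_on_has_derivative[OF that]]
    have "((\<lambda>s. F (a + s *\<^sub>R w)) has_derivative (\<lambda>k. dderiv F (a + s *\<^sub>R w) (k *\<^sub>R w))) (at s)" .
    then show ?thesis
      unfolding has_field_derivative_def by (simp add: linear_cmul[OF lin] mult.commute[of _ "dderiv F _ _"])
  qed
  have "\<exists>s. 0 < s \<and> s < h \<and> (f (x + h *\<^sub>R v + h *\<^sub>R u) - f (x + h *\<^sub>R u))
      - (f (x + h *\<^sub>R v + 0 *\<^sub>R u) - f (x + 0 *\<^sub>R u))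
      = (h - 0) * (dderiv f (x + h *\<^sub>R v + s *\<^sub>R u) u - dderiv f (x + s *\<^sub>R u) u)"
  proof (rule MVT2[of 0 h "\<lambda>s. f (x + h *\<^sub>R v + s *\<^sub>R u) - f (x + s *\<^sub>R u)"])
    fix s assume s: "0 \<le> s" "s \<le> h"
    have "x + h *\<^sub>R v + s *\<^sub>R u \<in> S" "x + s *\<^sub>R u \<in> S"
      using in_S[of s h] in_S[of s 0] s assms(2) by (auto simp: algebra_simps)
    then show "((\<lambda>s. f (x + h *\<^sub>R v + s *\<^sub>R u) - f (x + s *\<^sub>R u)) has_real_derivative
        dderiv f (x + h *\<^sub>R v + s *\<^sub>R u) u - dderiv f (x + s *\<^sub>R u) u) (at s)"
      by (intro DERIV_diff line assms(1))
  qed (use assms in auto)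
  then obtain s where s: "0 < s" "s < h" and eq1:
    "f (x + h *\<^sub>R v + h *\<^sub>R u) - f (x + h *\<^sub>R u) - (f (x + h *\<^sub>R v) - f x)
      = h * (dderiv f (x + h *\<^sub>R v + s *\<^sub>R u) u - dderiv f (x + s *\<^sub>R u) u)"
    by auto
  have "\<exists>t. 0 < t \<and> t < h \<and> dderiv f (x + s *\<^sub>R u + h *\<^sub>R v) u - dderiv f (x + s *\<^sub>R u + 0 *\<^sub>R v) u
      = (h - 0) * dderiv (\<lambda>y. dderiv f y u) (x + s *\<^sub>R u + t *\<^sub>R v) v"
  proof (rule MVT2[of 0 h "\<lambda>t. dderiv f (x + s *\<^sub>R u + t *\<^sub>R v) u"])
    fix t assume t: "0 \<le> t" "t \<le> h"
    show "((\<lambda>t. dderiv f (x + s *\<^sub>R u + t *\<^sub>R v) u) has_real_derivative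
        dderiv (\<lambda>y. dderiv f y u) (x + s *\<^sub>R u + t *\<^sub>R v) v) (at t)"
      by (rule line[where F="\<lambda>y. dderiv f y u"])
        (use in_S s t in \<open>auto intro: smooth_on_dderiv assms(1)\<close>)
  qed (use assms in auto)
  then obtain t where t: "0 < t" "t < h" and eq2:
    "dderiv f (x + s *\<^sub>R u + h *\<^sub>R v) u - dderiv f (x + s *\<^sub>R u) u
      = h * dderiv (\<lambda>y. dderiv f y u) (x + s *\<^sub>R u + t *\<^sub>R v) v"
    by auto
  have "x + h *\<^sub>R v + s *\<^sub>R u = x + s *\<^sub>R u + h *\<^sub>R v" "x + h *\<^sub>R v + h *\<^sub>R u = x + h *\<^sub>R u + h *\<^sub>R v"
    by (simp_all add: algebra_simps)
  then have "f (x + h *\<^sub>R u + h *\<^sub>R v) - f (x + h *\<^sub>R u) - f (x + h *\<^sub>R v) + f x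
      = h * h * dderiv (\<lambda>y. dderiv f y u) (x + s *\<^sub>R u + t *\<^sub>R v) v"
    using eq1 eq2 by (simp add: algebra_simps)
  with s t show ?thesis using that by blast
qed

text \<open>One and the same second difference, divided by the square of the side, is a value of either mixed
derivative somewhere in the parallelogram. If the two differed at \<open>x\<close>, then by continuity their
values near \<open>x\<close> would be separated.\<close>

lemma second_dderiv_commute_real:
  fixes f :: "'a::real_normed_vector \<Rightarrow> real"
  assumes S: "open S" "x \<in> S" and f: "smooth_on S f"
  shows "dderiv (\<lambda>y. dderiv f y u) x v = dderiv (\<lambda>y. dderiv f y v) x u"
    (is "?A x = ?B x")
proof (rule ccontr)
  assume neq: "?A x \<noteq> ?B x"
  \<comment> \<open>half the gap, so that the two derivatives stay apart as long as each moves by less than \<open>e\<close>\<close>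
  define e where "e = \<bar>?A x - ?B x\<bar> / 2"
  have e: "e > 0" using neq by (simp add: e_def)
  have cont: "continuous_on S ?A" "continuous_on S ?B"
    using smooth_on_dderiv[OF smooth_on_dderiv[OF f]]
    unfolding smooth_on_def by (metis Ck_on.simps(1))+
  have "continuous_on S (\<lambda>y. (?A y, ?B y))" using cont by (intro continuous_intros)
  then have "isCont (\<lambda>y. (?A y, ?B y)) x" using S continuous_on_eq_continuous_at by blast
  then have "isCont ?A x" "isCont ?B x" using cont S continuous_on_eq_continuous_at by blast+
  then have "\<forall>\<^sub>F y in at x. dist (?A y) (?A x) < e" "\<forall>\<^sub>F y in at x. dist (?B y) (?B x) < e"
    using e unfolding isCont_def tendsto_iff by blast+
  moreover have "\<forall>\<^sub>F y in at x. y \<in> S" using S eventually_at_topological by blast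
  ultimately have "\<forall>\<^sub>F y in at x. dist (?A y) (?A x) < e \<and> dist (?B y) (?B x) < e \<and> y \<in> S"
    by eventually_elim auto
  then obtain d where d: "d > 0"
    "\<And>y. y \<noteq> x \<Longrightarrow> dist y x < d \<Longrightarrow> dist (?A y) (?A x) < e \<and> dist (?B y) (?B x) < e \<and> y \<in> S"
    unfolding eventually_at by blast
  have near: "\<bar>?A y - ?A x\<bar> < e" "\<bar>?B y - ?B x\<bar> < e" "y \<in> S" if "dist y x < d" for y
    using d(2)[of y] that e S(2) by (cases "y = x"; simp add: dist_real_def)+
  \<comment> \<open>a side length for which the whole parallelogram lies in the ball of radius \<open>d\<close>\<close>
  define h where "h = d / (1 + norm u + norm v)"
  have pos: "1 + norm u + norm v > 0" by (simp add: add_pos_nonneg)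
  have h: "h > 0" using d pos by (simp add: h_def)
  have close: "dist (x + s *\<^sub>R u + t *\<^sub>R v) x < d" if "0 \<le> s" "s \<le> h" "0 \<le> t" "t \<le> h" for s t
  proof -
    have "norm (s *\<^sub>R u + t *\<^sub>R v) \<le> h * norm u + h * norm v"
      using that by (intro norm_triangle_le add_mono) (auto intro: mult_right_mono)
    also have "\<dots> < h * (1 + norm u + norm v)" using h by (simp add: algebra_simps)
    also have "\<dots> = d" using pos by (simp add: h_def)
    finally show ?thesis by (simp add: dist_norm add.assoc)
  qed
  obtain s t where st: "0 < s" "s < h" "0 < t" "t < h"
    and 1: "f (x + h *\<^sub>R u + h *\<^sub>R v) - f (x + h *\<^sub>R u) - f (x + h *\<^sub>R v) + f x
      = h * h * ?A (x + s *\<^sub>R u + t *\<^sub>R v)"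
    by (rule second_difference_mean_value[OF f h, of x u v]) (use near(3) close in blast)+
  obtain s' t' where st': "0 < s'" "s' < h" "0 < t'" "t' < h"
    and 2: "f (x + h *\<^sub>R v + h *\<^sub>R u) - f (x + h *\<^sub>R v) - f (x + h *\<^sub>R u) + f x
      = h * h * ?B (x + s' *\<^sub>R v + t' *\<^sub>R u)"
  proof (rule second_difference_mean_value[OF f h, of x v u])
    show "x + s *\<^sub>R v + t *\<^sub>R u \<in> S" if "0 \<le> s" "s \<le> h" "0 \<le> t" "t \<le> h" for s t
      using near(3)[OF close[of t s]] that by (simp add: algebra_simps)
  qed blast
  have sw: "x + s' *\<^sub>R v + t' *\<^sub>R u = x + t' *\<^sub>R u + s' *\<^sub>R v"
    "x + h *\<^sub>R v + h *\<^sub>R u = x + h *\<^sub>R u + h *\<^sub>R v"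
    by (simp_all add: algebra_simps)
  have "h * h * ?A (x + s *\<^sub>R u + t *\<^sub>R v) = h * h * ?B (x + t' *\<^sub>R u + s' *\<^sub>R v)"
    using 1 2 sw by (simp add: algebra_simps)
  then have "?A (x + s *\<^sub>R u + t *\<^sub>R v) = ?B (x + t' *\<^sub>R u + s' *\<^sub>R v)" using h by simp
  moreover have "\<bar>?A (x + s *\<^sub>R u + t *\<^sub>R v) - ?A x\<bar> < e"
    by (rule near(1)[OF close]) (use st in auto)
  moreover have "\<bar>?B (x + t' *\<^sub>R u + s' *\<^sub>R v) - ?B x\<bar> < e"
    by (rule near(2)[OF close]) (use st' in auto)
  ultimately show False unfolding e_def by argo
qed

lemma second_dderiv_commute:
  fixes f :: "'a::real_normed_vector \<Rightarrow> 'b::euclidean_space"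
  assumes S: "open S" "x \<in> S" and f: "smooth_on S f"
  shows "dderiv (\<lambda>y. dderiv f y u) x v = dderiv (\<lambda>y. dderiv f y v) x u"
proof (rule euclidean_eqI)
  fix b :: 'b assume "b \<in> Basis"
  have inner: "dderiv F y w \<bullet> b = dderiv (\<lambda>y. F y \<bullet> b) y w" if "smooth_on S F" "y \<in> S"
    for F :: "'a \<Rightarrow> 'b" and y w
    using smooth_on_has_derivative[OF that]
    by (intro dderiv_eqI[symmetric] has_derivative_inner_left)
  have "dderiv (\<lambda>y. dderiv f y u) x v \<bullet> b = dderiv (\<lambda>y. dderiv (\<lambda>y. f y \<bullet> b) y u) x v" for u v
  proof -
    have "dderiv (\<lambda>y. dderiv f y u) x v \<bullet> b = dderiv (\<lambda>y. dderiv f y u \<bullet> b) x v"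
      by (rule inner[OF smooth_on_dderiv[OF f] S(2)])
    also have "\<dots> = dderiv (\<lambda>y. dderiv (\<lambda>y. f y \<bullet> b) y u) x v"
      using dderiv_cong_open[OF S, of "\<lambda>y. dderiv f y u \<bullet> b"] inner[OF f] by metis
    finally show ?thesis .
  qed
  moreover have "smooth_on S (\<lambda>y. f y \<bullet> b)"
    by (rule smooth_on_linear[OF bounded_linear_inner_left S(1) f])
  ultimately show "dderiv (\<lambda>y. dderiv f y u) x v \<bullet> b = dderiv (\<lambda>y. dderiv f y v) x u \<bullet> b"
    using second_dderiv_commute_real[OF S] by simp
qed

section \<open>Differentiating tensor fields in coordinates\<close>

lemma linear_expansion:
  fixes L :: "real ^ 'n \<Rightarrow> 'b::real_vector"
  assumes "linear L"
  shows "L u = (\<Sum>i\<in>UNIV. u $ i *\<^sub>R L (axis i 1))"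
proof -
  have "L u = L (\<Sum>i\<in>UNIV. u $ i *\<^sub>R axis i 1)" using vec_expansion[of u] by simp
  then show ?thesis by (simp only: linear_sum[OF assms] linear_cmul[OF assms])
qed

text \<open>The product rule for a field of linear maps of which only the values on constant vectors are known
to be differentiable. All tensors below (metric, Christoffel symbols, Schouten endomorphism) are
functions of a point and of vectors, and are differentiated through this rule and its bilinear form.\<close>

lemma has_derivative_linear_field:
  fixes L :: "'a::real_normed_vector \<Rightarrow> real ^ 'n \<Rightarrow> 'b::real_normed_vector"
  assumes S: "open S" "x \<in> S" and lin: "\<And>y. y \<in> S \<Longrightarrow> linear (L y)"
    and L: "\<And>u. (\<lambda>y. L y u) differentiable at x" and Y: "(Y has_derivative Y') (at x)"
  shows "((\<lambda>y. L y (Y y)) has_derivative (\<lambda>h. dderiv (\<lambda>y. L y (Y x)) x h + L x (Y' h))) (at x)"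
proof -
  have Yi: "((\<lambda>y. Y y $ i) has_derivative (\<lambda>h. Y' h $ i)) (at x)" for i
    using Y bounded_linear.has_derivative[OF bounded_linear_vec_nth] by blast
  have fixed: "((\<lambda>y. L y u) has_derivative (\<lambda>h. \<Sum>i\<in>UNIV. u $ i *\<^sub>R dderiv (\<lambda>y. L y (axis i 1)) x h)) (at x)"
    for u
  proof (rule has_derivative_transform_within_open[OF _ S])
    show "((\<lambda>y. \<Sum>i\<in>UNIV. u $ i *\<^sub>R L y (axis i 1)) has_derivative
        (\<lambda>h. \<Sum>i\<in>UNIV. u $ i *\<^sub>R dderiv (\<lambda>y. L y (axis i 1)) x h)) (at x)"
      by (intro has_derivative_sum has_derivative_scaleR_right has_derivative_dderiv L)
  qed (rule linear_expansion[OF lin, symmetric])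
  have "((\<lambda>y. L y (Y y)) has_derivative (\<lambda>h. \<Sum>i\<in>UNIV. Y x $ i *\<^sub>R dderiv (\<lambda>y. L y (axis i 1)) x h
      + Y' h $ i *\<^sub>R L x (axis i 1))) (at x)"
  proof (rule has_derivative_transform_within_open[OF _ S])
    show "((\<lambda>y. \<Sum>i\<in>UNIV. Y y $ i *\<^sub>R L y (axis i 1)) has_derivative (\<lambda>h. \<Sum>i\<in>UNIV.
        Y x $ i *\<^sub>R dderiv (\<lambda>y. L y (axis i 1)) x h + Y' h $ i *\<^sub>R L x (axis i 1))) (at x)"
      by (intro has_derivative_sum has_derivative_scaleR Yi has_derivative_dderiv L)
  qed (rule linear_expansion[OF lin, symmetric])
  moreover have "(\<Sum>i\<in>UNIV. Y x $ i *\<^sub>R dderiv (\<lambda>y. L y (axis i 1)) x h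
      + Y' h $ i *\<^sub>R L x (axis i 1)) = dderiv (\<lambda>y. L y (Y x)) x h + L x (Y' h)" for h
    unfolding sum.distrib dderiv_eqI[OF fixed[of "Y x"]] linear_expansion[OF lin[OF S(2)], of "Y' h"] ..
  ultimately show ?thesis by simp
qed

lemma has_derivative_bilinear_field:
  fixes B :: "'a::real_normed_vector \<Rightarrow> real ^ 'n \<Rightarrow> real ^ 'm \<Rightarrow> 'b::real_normed_vector"
  assumes S: "open S" "x \<in> S" and lin: "\<And>y. y \<in> S \<Longrightarrow> bilinear (B y)"
    and B: "\<And>u v. (\<lambda>y. B y u v) differentiable at x"
    and Y: "(Y has_derivative Y') (at x)" and Z: "(Z has_derivative Z') (at x)"
  shows "((\<lambda>y. B y (Y y) (Z y)) has_derivative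
    (\<lambda>h. dderiv (\<lambda>y. B y (Y x) (Z x)) x h + B x (Y' h) (Z x) + B x (Y x) (Z' h))) (at x)"
proof -
  have 1: "((\<lambda>y. B y (Y y) v) has_derivative (\<lambda>h. dderiv (\<lambda>y. B y (Y x) v) x h + B x (Y' h) v)) (at x)"
    for v
    by (rule has_derivative_linear_field[OF S, where L="\<lambda>y u. B y u v"])
      (use lin B Y in \<open>auto simp: bilinear_def\<close>)
  have "((\<lambda>y. B y (Y y) (Z y)) has_derivative
    (\<lambda>h. dderiv (\<lambda>y. B y (Y y) (Z x)) x h + B x (Y x) (Z' h))) (at x)"
    by (rule has_derivative_linear_field[OF S, where L="\<lambda>y. B y (Y y)"])
      (use lin differentiableI[OF 1] Z in \<open>auto simp: bilinear_def\<close>)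
  then show ?thesis by (simp add: dderiv_eqI[OF 1])
qed

lemma smooth_on_linear_field:
  fixes L :: "'a::real_normed_vector \<Rightarrow> real ^ 'n \<Rightarrow> 'b::real_normed_vector"
  assumes S: "open S" and lin: "\<And>y. y \<in> S \<Longrightarrow> linear (L y)"
    and L: "\<And>u. smooth_on S (\<lambda>y. L y u)" and Y: "smooth_on S Y"
  shows "smooth_on S (\<lambda>y. L y (Y y))"
proof (rule smooth_on_cong[OF S])
  show "smooth_on S (\<lambda>y. \<Sum>i\<in>UNIV. Y y $ i *\<^sub>R L y (axis i 1))"
    by (intro smooth_on_sum smooth_on_scaleR smooth_on_nth S L Y) auto
qed (rule linear_expansion[OF lin, symmetric])

lemma smooth_on_bilinear_field:
  fixes B :: "'a::real_normed_vector \<Rightarrow> real ^ 'n \<Rightarrow> real ^ 'm \<Rightarrow> 'b::real_normed_vector"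
  assumes S: "open S" and lin: "\<And>y. y \<in> S \<Longrightarrow> bilinear (B y)"
    and B: "\<And>u v. smooth_on S (\<lambda>y. B y u v)" and Y: "smooth_on S Y" and Z: "smooth_on S Z"
  shows "smooth_on S (\<lambda>y. B y (Y y) (Z y))"
proof (rule smooth_on_linear_field[OF S, where L="\<lambda>y. B y (Y y)"])
  show "smooth_on S (\<lambda>y. B y (Y y) v)" for v
    by (rule smooth_on_linear_field[OF S, where L="\<lambda>y u. B y u v"])
      (use lin B Y in \<open>auto simp: bilinear_def\<close>)
qed (use lin Z in \<open>auto simp: bilinear_def\<close>)

lemma linear_dderiv_field:
  fixes L :: "'a::real_normed_vector \<Rightarrow> 'c::real_vector \<Rightarrow> 'b::real_normed_vector"
  assumes S: "open S" "x \<in> S" and lin: "\<And>y. y \<in> S \<Longrightarrow> linear (L y)"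
    and L: "\<And>u. smooth_on S (\<lambda>y. L y u)"
  shows "linear (\<lambda>u. dderiv (\<lambda>y. L y u) x w)"
proof (rule linearI)
  note der = smooth_on_has_derivative[OF L S(2)]
  show "dderiv (\<lambda>y. L y (a + b)) x w = dderiv (\<lambda>y. L y a) x w + dderiv (\<lambda>y. L y b) x w" for a b
    by (intro dderiv_eqI has_derivative_transform_within_open[OF has_derivative_add[OF der der] S])
      (simp add: linear_add[OF lin])
  show "dderiv (\<lambda>y. L y (c *\<^sub>R a)) x w = c *\<^sub>R dderiv (\<lambda>y. L y a) x w" for c a
    by (intro dderiv_eqI has_derivative_transform_within_open[OF has_derivative_scaleR_right[OF der] S])
      (simp add: linear_cmul[OF lin])
qed


section \<open>Inner products on three-space\<close>

text \<open>Index arithmetic in type \<open>3\<close> is modulo 3, but the simplifier adds numerals before reducing them.\<close>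

lemma cyclic_indices [simp]:
  "(4::3) = 1" "(5::3) = 2"
  by simp_all

lemma bilinearI:
  assumes "\<And>u. linear (B u)" "\<And>v. linear (\<lambda>u. B u v)"
  shows "bilinear B"
  using assms by (simp add: bilinear_def)

lemma bilinearD: "bilinear B \<Longrightarrow> linear (B u)" "bilinear B \<Longrightarrow> linear (\<lambda>u. B u v)"
  by (auto simp: bilinear_def)

locale inner_product3 =
  fixes G :: "real ^ 3 \<Rightarrow> real ^ 3 \<Rightarrow> real"
  assumes bilinear: "bilinear G" and sym: "G u v = G v u" and pos: "u \<noteq> 0 \<Longrightarrow> G u u > 0"
begin

lemmas add_left = bilinear_ladd[OF bilinear]
  and scale_left = bilinear_lmul[OF bilinear] and scale_right = bilinear_rmul[OF bilinear]
  and zero_left = bilinear_lzero[OF bilinear] and diff_left = bilinear_lsub[OF bilinear]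
  and neg_left = bilinear_lneg[OF bilinear] and sum_left = linear_sum[OF bilinearD(2)[OF bilinear]]

definition orthonormal :: "(3 \<Rightarrow> real ^ 3) \<Rightarrow> bool" where
  "orthonormal S \<longleftrightarrow> (\<forall>i j. G (S i) (S j) = (if i = j then 1 else 0))"

definition gram :: "real ^ 3 ^ 3" where
  "gram = (\<chi> i j. G (axis i 1) (axis j 1))"

lemma expand_right: "G w u = (\<Sum>i\<in>UNIV. u $ i * G w (axis i 1))"
  using linear_expansion[OF bilinearD(1)[OF bilinear], of w u] by simp

lemma expand_left: "G u w = (\<Sum>i\<in>UNIV. u $ i * G (axis i 1) w)"
  using linear_expansion[OF bilinearD(2)[OF bilinear], of u w] by simp

lemma gram_mult: "(gram *v u) $ i = G (axis i 1) u"
  by (simp add: expand_right[of "axis i 1" u] gram_def matrix_vector_mult_def mult.commute)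

lemma eqI: "(\<And>v. G u v = G w v) \<Longrightarrow> u = w"
  using pos[of "u - w"] by (force simp: diff_left)

lemma normalize:
  assumes "w \<noteq> 0"
  obtains c where "c > 0" "G (c *\<^sub>R w) (c *\<^sub>R w) = 1"
proof
  show "1 / sqrt (G w w) > 0" using pos[OF assms] by simp
  show "G ((1 / sqrt (G w w)) *\<^sub>R w) ((1 / sqrt (G w w)) *\<^sub>R w) = 1"
    using pos[OF assms] by (simp add: scale_left scale_right field_simps)
qed

text \<open>The Gram-Schmidt process on the standard basis only produces upper triangular matrices with
  positive diagonal, so the basis is automatically positively oriented.\<close>

lemma ex_orthonormal: "\<exists>S. orthonormal S \<and> det (\<chi> i. S i) > 0"
proof -
  let ?e = "\<lambda>i. axis i (1::real) :: real ^ 3"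
  note comp = axis_def if_distrib
  have "?e 1 \<noteq> 0" by (simp add: axis_eq_0_iff)
  from normalize[OF this] obtain a where a: "a > 0" "G (a *\<^sub>R ?e 1) (a *\<^sub>R ?e 1) = 1" .
  define s1 where "s1 = a *\<^sub>R ?e 1"
  have s1: "s1 $ 1 > 0" "s1 $ 2 = 0" "s1 $ 3 = 0" "G s1 s1 = 1"
    using a by (auto simp: s1_def comp)
  define w2 where "w2 = ?e 2 - G (?e 2) s1 *\<^sub>R s1"
  have w2: "w2 $ 2 = 1" "w2 $ 3 = 0" "G w2 s1 = 0"
    using s1 by (auto simp: w2_def comp diff_left scale_left)
  have "w2 \<noteq> 0" using w2(1) by auto
  from normalize[OF this] obtain b where b: "b > 0" "G (b *\<^sub>R w2) (b *\<^sub>R w2) = 1" .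
  define s2 where "s2 = b *\<^sub>R w2"
  have s2: "s2 $ 2 > 0" "s2 $ 3 = 0" "G s2 s2 = 1" "G s2 s1 = 0" "G s1 s2 = 0"
    using b w2 sym[of s1 s2] by (auto simp: s2_def scale_left)
  define w3 where "w3 = ?e 3 - G (?e 3) s1 *\<^sub>R s1 - G (?e 3) s2 *\<^sub>R s2"
  have w3: "w3 $ 3 = 1" "G w3 s1 = 0" "G w3 s2 = 0"
    using s1 s2 by (auto simp: w3_def comp diff_left scale_left)
  have "w3 \<noteq> 0" using w3(1) by auto
  from normalize[OF this] obtain c where c: "c > 0" "G (c *\<^sub>R w3) (c *\<^sub>R w3) = 1" .
  define s3 where "s3 = c *\<^sub>R w3"
  have s3: "s3 $ 3 > 0" "G s3 s3 = 1" "G s3 s1 = 0" "G s3 s2 = 0" "G s1 s3 = 0" "G s2 s3 = 0"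
    using c w3 sym[of s1 s3] sym[of s2 s3] by (auto simp: s3_def scale_left)
  define S where "S i = (if i = 1 then s1 else if i = 2 then s2 else s3)" for i :: 3
  have S: "S 1 = s1" "S 2 = s2" "S 3 = s3" by (auto simp: S_def)
  have "orthonormal S" unfolding orthonormal_def by (simp add: forall_3 S s1 s2 s3)
  moreover have "det (\<chi> i. S i) > 0" by (simp add: det_3 S s1 s2 s3)
  ultimately show ?thesis by blast
qed

lemma orthonormal_gram:
  assumes "orthonormal S"
  shows "((\<chi> i. S i) ** gram) ** transpose (\<chi> i. S i) = mat 1"
proof -
  have "(((\<chi> i. S i) ** gram) ** transpose (\<chi> i. S i)) $ i $ j = G (S i) (S j)" for i j
    by (simp add: expand_right[of "S i" "S j"] expand_left[of "S i" "axis _ 1"]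
        matrix_matrix_mult_def transpose_def gram_def mult.commute)
  with assms show ?thesis by (simp add: vec_eq_iff mat_def orthonormal_def)
qed

lemma orthonormal_det: "orthonormal S \<Longrightarrow> (det (\<chi> i. S i))\<^sup>2 * det gram = 1"
  using arg_cong[OF orthonormal_gram, of S det]
  by (simp add: det_mul power2_eq_square mult.commute mult.left_commute)

lemma det_gram_pos: "det gram > 0"
proof -
  obtain S where "orthonormal S" using ex_orthonormal by blast
  then have "(det (\<chi> i. S i))\<^sup>2 * det gram > 0" using orthonormal_det by simp
  then show ?thesis by (simp add: zero_less_mult_iff not_less[symmetric])
qed

text \<open>The rows of the matrix \<open>A\<close> of the basis satisfy \<open>A ** gram ** A\<^sup>T = 1\<close>; moving the factor \<open>A\<^sup>T\<close> to the
left, as one-sided inverses of square matrices are two-sided, gives the expansion.\<close>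

lemma orthonormal_expansion:
  assumes "orthonormal S"
  shows "u = (\<Sum>i\<in>UNIV. G u (S i) *\<^sub>R S i)"
proof -
  let ?A = "\<chi> i. S i"
  have row: "((?A ** gram) *v u) $ i = G u (S i)" for i
  proof -
    have "((?A ** gram) *v u) $ i = (?A *v (gram *v u)) $ i"
      by (simp only: matrix_vector_mul_assoc)
    also have "\<dots> = (\<Sum>j\<in>UNIV. S i $ j * G (axis j 1) u)"
      by (simp add: matrix_vector_mult_def[of ?A] gram_mult)
    also have "\<dots> = G u (S i)"
      using expand_left[of "S i" u] by (simp add: sym[of u])
    finally show ?thesis .
  qed
  have "transpose ?A ** (?A ** gram) = mat 1"
    using orthonormal_gram[OF assms] matrix_left_right_inverse by blast
  then have "u = transpose ?A *v ((?A ** gram) *v u)"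
    by (metis matrix_vector_mul_assoc matrix_vector_mul_lid)
  moreover have "(transpose ?A *v ((?A ** gram) *v u)) $ k = (\<Sum>i\<in>UNIV. G u (S i) *\<^sub>R S i) $ k" for k
    by (simp only: matrix_vector_mult_def[of "transpose ?A"] vec_lambda_beta row)
      (simp add: transpose_def mult.commute)
  ultimately show ?thesis by (simp add: vec_eq_iff)
qed

lemma orthonormal_trace:
  assumes "orthonormal S" "linear L"
  shows "(\<Sum>i\<in>UNIV. L (axis i 1) $ i) = (\<Sum>j\<in>UNIV. G (L (S j)) (S j))"
proof -
  have "(\<Sum>i\<in>UNIV. L (axis i 1) $ i) = (\<Sum>i\<in>UNIV. \<Sum>j\<in>UNIV. L (S j) $ i * G (axis i 1) (S j))"
  proof (rule sum.cong[OF refl])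
    fix i
    have "L (axis i 1) = (\<Sum>j\<in>UNIV. G (axis i 1) (S j) *\<^sub>R L (S j))"
      by (subst orthonormal_expansion[OF assms(1), of "axis i 1"])
        (simp only: linear_sum[OF assms(2)] linear_cmul[OF assms(2)])
    then show "L (axis i 1) $ i = (\<Sum>j\<in>UNIV. L (S j) $ i * G (axis i 1) (S j))"
      by (simp add: mult.commute)
  qed
  also have "\<dots> = (\<Sum>j\<in>UNIV. \<Sum>i\<in>UNIV. L (S j) $ i * G (axis i 1) (S j))" by (rule sum.swap)
  also have "\<dots> = (\<Sum>j\<in>UNIV. G (L (S j)) (S j))"
  proof (rule sum.cong[OF refl])
    fix j
    show "(\<Sum>i\<in>UNIV. L (S j) $ i * G (axis i 1) (S j)) = G (L (S j)) (S j)"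
      using linear_expansion[OF bilinearD(2)[OF bilinear], of "L (S j)" "S j"] by simp
  qed
  finally show ?thesis .
qed

text \<open>The left-hand side is the Hodge star of \<open>\<beta>\<close> at \<open>u\<close>. The cofactors of the matrix of \<open>S\<close> are its
  determinant times the dual basis, so summing over \<open>S\<close> leaves the determinant and an expression in
  the standard basis; and the determinant of an oriented orthonormal basis depends on \<open>G\<close> alone.\<close>

lemma hodge_standard_basis:
  fixes \<beta> :: "real ^ 3 \<Rightarrow> real ^ 3 \<Rightarrow> real ^ 3"
  assumes S: "orthonormal S" "det (\<chi> i. S i) > 0"
    and \<beta>: "bilinear \<beta>" "\<And>a b. \<beta> a b = - \<beta> b a"
  shows "(\<Sum>i\<in>UNIV. G u (S i) *\<^sub>R \<beta> (S (i + 1)) (S (i + 2)))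
    = (1 / sqrt (det gram)) *\<^sub>R (\<Sum>c\<in>UNIV. G u (axis c 1) *\<^sub>R \<beta> (axis (c + 1) 1) (axis (c + 2) 1))"
proof -
  have "1 / det gram = (det (\<chi> i. S i))\<^sup>2"
    using orthonormal_det[OF S(1)] det_gram_pos by (simp add: field_simps)
  then have det: "1 / sqrt (det gram) = det (\<chi> i. S i)" 
    using S(2) by (metis abs_of_pos real_sqrt_abs real_sqrt_divide real_sqrt_one)
  let ?e = "\<lambda>i. axis i (1::real) :: real ^ 3"
  have anti: "\<beta> a a $ k = 0" for a k using \<beta>(2)[of a a] by (simp add: vec_eq_iff)
  have swap: "\<beta> (?e 2) (?e 1) $ k = - \<beta> (?e 1) (?e 2) $ k" "\<beta> (?e 3) (?e 2) $ k = - \<beta> (?e 2) (?e 3) $ k"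
    "\<beta> (?e 1) (?e 3) $ k = - \<beta> (?e 3) (?e 1) $ k" for k
    using \<beta>(2) by (metis vector_uminus_component)+
  have exp: "\<beta> a b $ k = (\<Sum>c\<in>UNIV. (a $ (c + 1) * b $ (c + 2) - a $ (c + 2) * b $ (c + 1))
      * \<beta> (?e (c + 1)) (?e (c + 2)) $ k)" for a b k
    unfolding linear_expansion[OF bilinearD(2)[OF \<beta>(1)], of a b]
      linear_expansion[OF bilinearD(1)[OF \<beta>(1)], of "?e i" b for i]
    by (simp add: sum_3 anti swap algebra_simps)
  have Gexp: "G u w = w $ 1 * G u (?e 1) + w $ 2 * G u (?e 2) + w $ 3 * G u (?e 3)" for w
    using expand_right[of u w] by (simp add: sum_3)
  show ?thesis
    unfolding det vec_eq_iff
  proof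
    fix k
    show "(\<Sum>i\<in>UNIV. G u (S i) *\<^sub>R \<beta> (S (i + 1)) (S (i + 2))) $ k = (det (\<chi> i. S i) *\<^sub>R
        (\<Sum>c\<in>UNIV. G u (?e c) *\<^sub>R \<beta> (?e (c + 1)) (?e (c + 2)))) $ k"
      by (simp add: sum_3 det_3 Gexp[of "S 1"] Gexp[of "S 2"] Gexp[of "S 3"]
          exp[of "S 1" "S 2"] exp[of "S 2" "S 3"] exp[of "S 3" "S 1"])
        (simp add: algebra_simps)
  qed
qed

text \<open>The vector dual to a linear form with components \<open>l\<close>, by Cramer's rule; this way it is visibly a
  smooth function of \<open>l\<close> and of the inner product.\<close>

definition sharp :: "real ^ 3 \<Rightarrow> real ^ 3" where
  "sharp l = (\<chi> k. det (\<chi> i j. if j = k then l $ i else gram $ i $ j) / det gram)"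

lemma sharp_iff:
  assumes "linear f"
  shows "w = sharp (\<chi> i. f (axis i 1)) \<longleftrightarrow> (\<forall>v. G w v = f v)"
proof -
  have "w = sharp (\<chi> i. f (axis i 1)) \<longleftrightarrow> gram *v w = (\<chi> i. f (axis i 1))"
    unfolding sharp_def using cramer[of gram w] det_gram_pos by simp
  also have "\<dots> \<longleftrightarrow> (\<forall>i. G w (axis i 1) = f (axis i 1))"
    by (simp add: vec_eq_iff gram_mult sym)
  also have "\<dots> \<longleftrightarrow> (\<forall>v. G w v = f v)"
  proof
    assume *: "\<forall>i. G w (axis i 1) = f (axis i 1)"
    show "\<forall>v. G w v = f v"
    proof
      fix v show "G w v = f v" using expand_right[of w v] linear_expansion[OF assms, of v] * by simp
    qed
  qed simp
  finally show ?thesis .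
qed

text \<open>The algebraic core. If the Ricci tensor is diagonal in an orthonormal basis \<open>S\<close>, then its entry
  \<open>(j, k)\<close>, a sum with a single term \<open>G (R (S i) (S j) (S k)) (S i)\<close> for \<open>i\<close> different from \<open>j\<close> and \<open>k\<close>,
  vanishes, hence so does \<open>R (S i) (S j) (S k)\<close>, and \<open>P\<close> is diagonal too. The proof does the same
  computation in an arbitrary orthonormal basis: \<open>R\<close> has six independent components there, and the sum
  in question vanishes identically as a polynomial in them and \<open>s\<close>.\<close>

lemma curvature_ricci_cyclic:
  fixes R :: "real ^ 3 \<Rightarrow> real ^ 3 \<Rightarrow> real ^ 3 \<Rightarrow> real ^ 3"
  assumes lin: "\<And>b c. linear (\<lambda>a. R a b c)" "\<And>a c. linear (\<lambda>b. R a b c)" "\<And>a b. linear (R a b)"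
    and anti: "\<And>a b c. R a b c = - R b a c"
    and bianchi: "\<And>a b c. R a b c + R b c a + R c a b = 0"
    and skew: "\<And>a b c d. G (R a b c) d = - G c (R a b d)"
    and P: "linear P" "\<And>a b. G (P a) b = (\<Sum>i\<in>UNIV. R (axis i 1) a b $ i) - s * G a b"
  shows "R a b (P c) + R b c (P a) + R c a (P b) = 0"
proof -
  obtain S where S: "orthonormal S" using ex_orthonormal by blast
  define r where "r i j k l = G (R (S i) (S j) (S k)) (S l)" for i j k l
  define T where "T a b c = R a b (P c) + R b c (P a) + R c a (P b)" for a b c
  have r1: "r i j k l = - r j i k l" for i j k l
    unfolding r_def using anti[of "S i" "S j"] by (simp add: neg_left)
  have r2: "r i j k l = - r i j l k" for i j k l
    unfolding r_def using skew[of "S i" "S j" "S k"] sym by metis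
  have r3: "r i j k l + r j k i l + r k i j l = 0" for i j k l
    unfolding r_def using bianchi[of "S i" "S j" "S k"] by (metis add_left zero_left)
  have rz: "r i i k l = 0" "r i j k k = 0" for i j k l
    using r1[of i i k l] r2[of i j k k] by auto
  \<comment> \<open>the pair symmetry, from four instances of the Bianchi identity\<close>
  have r4: "r i j k l = r k l i j" for i j k l
    using r3[of i j k l] r3[of j k l i] r3[of k l i j] r3[of l i j k]
      r2[of i j l k] r2[of j k l i] r1[of i k l j] r2[of k i l j] r2[of k l j i] r1[of j l i k]
      r2[of l j i k] r2[of l i j k]
    by linarith
  have GS: "G (S i) (S j) = (if i = j then 1 else 0)" for i j using S by (simp add: orthonormal_def)
  have PS: "G (P (S k)) (S d) = (\<Sum>i\<in>UNIV. r i k d i) - s * (if k = d then 1 else 0)" for k d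
    using P(2)[of "S k" "S d"] orthonormal_trace[OF S lin(1)] GS by (simp add: r_def)
  have RP: "G (R (S i) (S j) (P (S k))) (S l)
      = (\<Sum>d\<in>UNIV. ((\<Sum>m\<in>UNIV. r m k d m) - s * (if k = d then 1 else 0)) * r i j d l)" for i j k l
  proof -
    have "R (S i) (S j) (P (S k)) = (\<Sum>d\<in>UNIV. G (P (S k)) (S d) *\<^sub>R R (S i) (S j) (S d))"
      by (subst orthonormal_expansion[OF S, of "P (S k)"]) (simp only: linear_sum[OF lin(3)] linear_cmul[OF lin(3)])
    then show ?thesis by (simp add: sum_left scale_left PS r_def)
  qed
  have "R x x c = 0" for x c using anti[of x x c] by (simp add: vec_eq_iff)
  then have T0: "T x x c = 0" "T x c x = 0" "T c x x = 0" for x c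
    using anti[of x c] by (simp_all add: T_def)
  have Tcyc: "T a b c = T b c a" for a b c by (simp add: T_def add_ac)
  have Tanti: "T a b c = - T b a c" for a b c
    using anti[of a b] anti[of b c] anti[of c a] by (simp add: T_def)
  have "G (T (S 1) (S 2) (S 3)) (S l) = 0" for l
  proof -
    \<comment> \<open>rewriting every component to one of the six independent ones\<close>
    have n: "r 2 1 k l = - r 1 2 k l" "r 3 1 k l = - r 1 3 k l" "r 3 2 k l = - r 2 3 k l"
      "r i j 2 1 = - r i j 1 2" "r i j 3 1 = - r i j 1 3" "r i j 3 2 = - r i j 2 3" for i j k l
      using r1 r2 by metis+
    have m: "r 1 3 1 2 = r 1 2 1 3" "r 2 3 1 2 = r 1 2 2 3" "r 2 3 1 3 = r 1 3 2 3" using r4 by metis+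
    have "l = 1 \<or> l = 2 \<or> l = 3" by (rule exhaust_3)
    then show ?thesis
      by (elim disjE) (simp_all add: T_def add_left RP sum_3 n m rz algebra_simps)
  qed
  then have T123: "T (S 1) (S 2) (S 3) = 0"
    using orthonormal_expansion[OF S, of "T (S 1) (S 2) (S 3)"] by simp
  \<comment> \<open>\<open>T\<close> is an alternating trilinear map, so one value determines it\<close>
  have TS: "T (S i) (S j) (S k) = 0" for i j k
  proof -
    have "T (S 2) (S 3) (S 1) = 0" "T (S 3) (S 1) (S 2) = 0" using T123 Tcyc by metis+
    then show ?thesis
      using T123 T0 Tanti[of "S 2" "S 1" "S 3"] Tanti[of "S 3" "S 2" "S 1"] Tanti[of "S 1" "S 3" "S 2"]
        exhaust_3[of i] exhaust_3[of j] exhaust_3[of k] by (elim disjE) simp_all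
  qed
  have linT: "linear (\<lambda>a. T a b c)" for b c
    unfolding T_def
    by (intro linear_compose_add lin linear_compose[OF P(1) lin(3), unfolded o_def])
  have ext: "f = (\<lambda>_. 0)" if "linear f" "\<And>i. f (S i) = 0" for f :: "real ^ 3 \<Rightarrow> real ^ 3"
  proof
    fix a show "f a = 0"
      by (subst orthonormal_expansion[OF S, of a]) (simp add: linear_sum[OF that(1)] linear_cmul[OF that(1)] that(2))
  qed
  have "T a (S j) (S k) = 0" for a j k using ext[OF linT TS] by metis
  then have "T (S k) a (S j) = 0" for a j k using Tcyc by metis
  then have "T a b (S j) = 0" for a b j using ext[OF linT] by metis
  then have "T (S j) a b = 0" for a b j using Tcyc by metis
  then have "T a b c = 0" using ext[OF linT] by metis
  then show ?thesis by (simp add: T_def)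
qed

end


section \<open>Riemannian geometry in a coordinate domain\<close>

abbreviation E :: "3 \<Rightarrow> real ^ 3" where "E i \<equiv> axis i 1"

text \<open>A metric \<open>G\<close> on an open set, and the Christoffel symbols \<open>\<Gamma>\<close> of its Levi-Civita connection as
  a bilinear map: \<open>\<Gamma> x u v\<close> is the covariant derivative at \<open>x\<close> of the constant field \<open>v\<close> along \<open>u\<close>.\<close>

locale coordinate_geometry =
  fixes V :: "(real ^ 3) set" and G :: "real ^ 3 \<Rightarrow> real ^ 3 \<Rightarrow> real ^ 3 \<Rightarrow> real"
    and \<Gamma> :: "real ^ 3 \<Rightarrow> real ^ 3 \<Rightarrow> real ^ 3 \<Rightarrow> real ^ 3"
  assumes open_V: "open V"
    and inner_product_G: "x \<in> V \<Longrightarrow> inner_product3 (G x)"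
    and smooth_G: "smooth_on V (\<lambda>x. G x u v)"
    and bilinear_\<Gamma>: "x \<in> V \<Longrightarrow> bilinear (\<Gamma> x)"
    and smooth_\<Gamma>: "smooth_on V (\<lambda>x. \<Gamma> x u v)"
    and torsion_free: "x \<in> V \<Longrightarrow> \<Gamma> x u v = \<Gamma> x v u"
    and metric: "x \<in> V \<Longrightarrow> dderiv (\<lambda>y. G y u v) x w = G x (\<Gamma> x w u) v + G x u (\<Gamma> x w v)"
begin

definition cov :: "(real ^ 3 \<Rightarrow> real ^ 3) \<Rightarrow> (real ^ 3 \<Rightarrow> real ^ 3) \<Rightarrow> real ^ 3 \<Rightarrow> real ^ 3" where
  "cov X Y x = dderiv Y x (X x) + \<Gamma> x (X x) (Y x)"

definition Riem :: "real ^ 3 \<Rightarrow> real ^ 3 \<Rightarrow> real ^ 3 \<Rightarrow> real ^ 3 \<Rightarrow> real ^ 3" where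
  "Riem x u v w = dderiv (\<lambda>y. \<Gamma> y v w) x u - dderiv (\<lambda>y. \<Gamma> y u w) x v
    + \<Gamma> x u (\<Gamma> x v w) - \<Gamma> x v (\<Gamma> x u w)"

lemmas bilinear_G = inner_product3.bilinear[OF inner_product_G]

lemma \<Gamma>_simps:
  assumes "x \<in> V"
  shows "\<Gamma> x (a + b) c = \<Gamma> x a c + \<Gamma> x b c" "\<Gamma> x c (a + b) = \<Gamma> x c a + \<Gamma> x c b"
    "\<Gamma> x (a - b) c = \<Gamma> x a c - \<Gamma> x b c" "\<Gamma> x c (a - b) = \<Gamma> x c a - \<Gamma> x c b"
    "\<Gamma> x (r *\<^sub>R a) c = r *\<^sub>R \<Gamma> x a c" "\<Gamma> x c (r *\<^sub>R a) = r *\<^sub>R \<Gamma> x c a"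
  using bilinear_\<Gamma>[OF assms]
  by (simp_all add: bilinear_ladd bilinear_radd bilinear_lsub bilinear_rsub bilinear_lmul bilinear_rmul)

lemma G_simps:
  assumes "x \<in> V"
  shows "G x (a + b) c = G x a c + G x b c" "G x c (a + b) = G x c a + G x c b"
    "G x (a - b) c = G x a c - G x b c" "G x c (a - b) = G x c a - G x c b"
    "G x (r *\<^sub>R a) c = r * G x a c" "G x c (r *\<^sub>R a) = r * G x c a"
  using bilinear_G[OF assms]
  by (simp_all add: bilinear_ladd bilinear_radd bilinear_lsub bilinear_rsub bilinear_lmul bilinear_rmul)

lemma differentiable_\<Gamma>: "x \<in> V \<Longrightarrow> (\<lambda>y. \<Gamma> y u v) differentiable at x"
  by (rule smooth_on_differentiable[OF smooth_\<Gamma>])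

lemma smooth_on_dderiv_along:
  assumes W: "open W" "W \<subseteq> V" and X: "smooth_on W X" and Y: "smooth_on W Y"
  shows "smooth_on W (\<lambda>x. dderiv Y x (X x))"
  by (rule smooth_on_linear_field[OF W(1), where L="dderiv Y"])
    (use X Y in \<open>auto intro: linear_frechet_derivative smooth_on_differentiable smooth_on_dderiv\<close>)

lemma smooth_cov:
  assumes W: "open W" "W \<subseteq> V" and X: "smooth_on W X" and Y: "smooth_on W Y"
  shows "smooth_on W (cov X Y)"
proof -
  have "smooth_on W (\<lambda>x. \<Gamma> x (X x) (Y x))"
    by (rule smooth_on_bilinear_field[OF W(1)])
      (use W X Y bilinear_\<Gamma> smooth_on_subset[OF smooth_\<Gamma>] in auto)
  then show ?thesis
    unfolding cov_def by (intro smooth_on_add smooth_on_dderiv_along assms)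
qed

lemma dderiv_\<Gamma>_field:
  assumes x: "x \<in> V" and Y: "(Y has_derivative Y') (at x)" and Z: "(Z has_derivative Z') (at x)"
  shows "((\<lambda>y. \<Gamma> y (Y y) (Z y)) has_derivative
    (\<lambda>h. dderiv (\<lambda>y. \<Gamma> y (Y x) (Z x)) x h + \<Gamma> x (Y' h) (Z x) + \<Gamma> x (Y x) (Z' h))) (at x)"
  by (rule has_derivative_bilinear_field[OF open_V x bilinear_\<Gamma> differentiable_\<Gamma>[OF x] Y Z])

text \<open>The second derivatives of \<open>Z\<close> cancel by symmetry, those of its first derivatives that are paired
  with \<open>\<Gamma>\<close> between the two iterated covariant derivatives, and the derivatives of \<open>X\<close> and \<open>Y\<close> against
  the bracket. Only the values of the three fields at \<open>x\<close> remain.\<close>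

lemma curvature_tensorial:
  assumes W: "open W" "W \<subseteq> V" "x \<in> W"
    and X: "smooth_on W X" and Y: "smooth_on W Y" and Z: "smooth_on W Z"
  shows "cov X (cov Y Z) x - cov Y (cov X Z) x - cov (\<lambda>y. dderiv Y y (X y) - dderiv X y (Y y)) Z x
    = Riem x (X x) (Y x) (Z x)"
proof -
  have xV: "x \<in> V" using W by auto
  have lin: "linear (dderiv Z y)" if "y \<in> W" for y
    using that Z by (auto intro: linear_frechet_derivative smooth_on_differentiable)
  note der = smooth_on_has_derivative[OF _ W(3)]
  have cov_der: "dderiv (cov A Z) x h = dderiv (\<lambda>y. dderiv Z y (A x)) x h + dderiv Z x (dderiv A x h)
      + (dderiv (\<lambda>y. \<Gamma> y (A x) (Z x)) x h + \<Gamma> x (dderiv A x h) (Z x) + \<Gamma> x (A x) (dderiv Z x h))"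
    if A: "smooth_on W A" for A h
  proof -
    have "((\<lambda>y. dderiv Z y (A y)) has_derivative
        (\<lambda>h. dderiv (\<lambda>y. dderiv Z y (A x)) x h + dderiv Z x (dderiv A x h))) (at x)"
      by (rule has_derivative_linear_field[OF W(1,3), where L="dderiv Z"])
        (use lin der[OF A] smooth_on_differentiable[OF smooth_on_dderiv[OF Z] W(3)] in auto)
    from has_derivative_add[OF this dderiv_\<Gamma>_field[OF xV der[OF A] der[OF Z]]]
    show ?thesis unfolding cov_def[abs_def] by (rule dderiv_eqI)
  qed
  have sym: "dderiv (\<lambda>y. dderiv Z y (Y x)) x (X x) = dderiv (\<lambda>y. dderiv Z y (X x)) x (Y x)"
    by (rule second_dderiv_commute[OF W(1,3) Z])
  show ?thesis
    unfolding cov_def[of _ "cov _ _"] cov_def[of _ Z] cov_der[OF X] cov_der[OF Y] Riem_def sym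
    by (simp add: cov_def \<Gamma>_simps[OF xV] linear_diff[OF lin[OF W(3)]] algebra_simps)
qed

lemma linear_\<Gamma>: "x \<in> V \<Longrightarrow> linear (\<Gamma> x u)" "x \<in> V \<Longrightarrow> linear (\<lambda>u. \<Gamma> x u v)"
  using bilinearD[OF bilinear_\<Gamma>] by auto

lemma linear_Riem:
  assumes x: "x \<in> V"
  shows "linear (\<lambda>u. Riem x u v w)" "linear (\<lambda>v. Riem x u v w)" "linear (Riem x u v)"
proof -
  have d: "linear (\<lambda>u. dderiv (\<lambda>y. \<Gamma> y v w) x u)" for v w
    by (rule linear_frechet_derivative[OF differentiable_\<Gamma>[OF x]])
  have d1: "linear (\<lambda>v. dderiv (\<lambda>y. \<Gamma> y v w) x u)" for u w
    by (rule linear_dderiv_field[OF open_V x, where L="\<lambda>y v. \<Gamma> y v w"]) (auto intro: linear_\<Gamma> smooth_\<Gamma>)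
  have d2: "linear (\<lambda>w. dderiv (\<lambda>y. \<Gamma> y v w) x u)" for u v
    by (rule linear_dderiv_field[OF open_V x, where L="\<lambda>y w. \<Gamma> y v w"]) (auto intro: linear_\<Gamma> smooth_\<Gamma>)
  note comp = linear_compose[OF linear_\<Gamma>(1)[OF x] linear_\<Gamma>(1)[OF x], unfolded o_def]
    linear_compose[OF linear_\<Gamma>(2)[OF x] linear_\<Gamma>(1)[OF x], unfolded o_def]
  show "linear (\<lambda>u. Riem x u v w)" "linear (\<lambda>v. Riem x u v w)" "linear (Riem x u v)"
    unfolding Riem_def[abs_def]
    by (intro linear_compose_add linear_compose_sub d d1 d2 comp linear_\<Gamma> x)+
qed

lemma smooth_Riem: "smooth_on V (\<lambda>x. Riem x u v w)"
  unfolding Riem_def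
  by (intro smooth_on_add smooth_on_diff smooth_on_dderiv smooth_\<Gamma> open_V
      smooth_on_bilinear_field[where B=\<Gamma>, OF open_V bilinear_\<Gamma> smooth_\<Gamma>] smooth_on_const)

lemma Riem_antisym: "Riem x u v w = - Riem x v u w"
  by (simp add: Riem_def)

text \<open>With \<open>\<Gamma>\<close> symmetric, the six derivatives and the six quadratic terms cancel in pairs.\<close>

lemma Riem_bianchi:
  assumes x: "x \<in> V"
  shows "Riem x u v w + Riem x v w u + Riem x w u v = 0"
proof -
  have "dderiv (\<lambda>y. \<Gamma> y a b) x c = dderiv (\<lambda>y. \<Gamma> y b a) x c" for a b c
    using dderiv_cong_open[OF open_V x, of "\<lambda>y. \<Gamma> y a b" "\<lambda>y. \<Gamma> y b a"] torsion_free by metis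
  from this[of u v] this[of v w] this[of w u] show ?thesis
    unfolding Riem_def using torsion_free[OF x, of u v] torsion_free[OF x, of v w] torsion_free[OF x, of w u]
    by simp
qed

lemma dderiv_G_field:
  assumes x: "x \<in> V" and Y: "(Y has_derivative Y') (at x)" and Z: "(Z has_derivative Z') (at x)"
  shows "((\<lambda>y. G y (Y y) (Z y)) has_derivative (\<lambda>h. G x (Y' h + \<Gamma> x h (Y x)) (Z x)
    + G x (Y x) (Z' h + \<Gamma> x h (Z x)))) (at x)"
proof -
  have "((\<lambda>y. G y (Y y) (Z y)) has_derivative
    (\<lambda>h. dderiv (\<lambda>y. G y (Y x) (Z x)) x h + G x (Y' h) (Z x) + G x (Y x) (Z' h))) (at x)"
    by (rule has_derivative_bilinear_field[OF open_V x bilinear_G _ Y Z])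
      (auto intro: smooth_on_differentiable[OF smooth_G x])
  then show ?thesis by (simp add: metric[OF x] G_simps[OF x] algebra_simps)
qed

text \<open>Commuting the second derivatives of \<open>G y w z\<close> gives the skew symmetry of the curvature.\<close>

lemma Riem_skew:
  assumes x: "x \<in> V"
  shows "G x (Riem x u v w) z = - G x w (Riem x u v z)"
proof -
  have second: "dderiv (\<lambda>y. dderiv (\<lambda>y. G y w z) y a) x b
      = G x (dderiv (\<lambda>y. \<Gamma> y a w) x b + \<Gamma> x b (\<Gamma> x a w)) z + G x (\<Gamma> x a w) (\<Gamma> x b z)
      + (G x (\<Gamma> x b w) (\<Gamma> x a z) + G x w (dderiv (\<lambda>y. \<Gamma> y a z) x b + \<Gamma> x b (\<Gamma> x a z)))" for a b
  proof -
    have D: "((\<lambda>y. \<Gamma> y a c) has_derivative dderiv (\<lambda>y. \<Gamma> y a c) x) (at x)" for c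
      by (rule has_derivative_dderiv[OF differentiable_\<Gamma>[OF x]])
    have C: "((\<lambda>y. c) has_derivative (\<lambda>h. 0)) (at x)" for c :: "real ^ 3"
      by (rule has_derivative_const)
    have "dderiv (\<lambda>y. dderiv (\<lambda>y. G y w z) y a) x b
        = dderiv (\<lambda>y. G y (\<Gamma> y a w) z + G y w (\<Gamma> y a z)) x b"
      using dderiv_cong_open[OF open_V x, of "\<lambda>y. dderiv (\<lambda>y. G y w z) y a"] metric by simp
    also have "\<dots> = G x (dderiv (\<lambda>y. \<Gamma> y a w) x b + \<Gamma> x b (\<Gamma> x a w)) z + G x (\<Gamma> x a w) (0 + \<Gamma> x b z)
      + (G x (0 + \<Gamma> x b w) (\<Gamma> x a z) + G x w (dderiv (\<lambda>y. \<Gamma> y a z) x b + \<Gamma> x b (\<Gamma> x a z)))"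
      by (rule dderiv_eqI[OF has_derivative_add[OF dderiv_G_field[OF x D C] dderiv_G_field[OF x C D]]])
    finally show ?thesis by simp
  qed
  show ?thesis
    using second_dderiv_commute[OF open_V x smooth_G, of w z u v] second
    by (simp add: Riem_def G_simps[OF x] algebra_simps)
qed

definition Ric :: "real ^ 3 \<Rightarrow> real ^ 3 \<Rightarrow> real ^ 3 \<Rightarrow> real" where
  "Ric x u v = (\<Sum>i\<in>UNIV. Riem x (E i) u v $ i)"

definition Ric_endo :: "real ^ 3 \<Rightarrow> real ^ 3 \<Rightarrow> real ^ 3" where
  "Ric_endo x u = inner_product3.sharp (G x) (\<chi> i. Ric x u (E i))"

definition Scal :: "real ^ 3 \<Rightarrow> real" where
  "Scal x = (\<Sum>i\<in>UNIV. Ric_endo x (E i) $ i)"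

definition Sch :: "real ^ 3 \<Rightarrow> real ^ 3 \<Rightarrow> real ^ 3 \<Rightarrow> real" where
  "Sch x u v = Ric x u v - Scal x / 4 * G x u v"

definition Sch_endo :: "real ^ 3 \<Rightarrow> real ^ 3 \<Rightarrow> real ^ 3" where
  "Sch_endo x u = inner_product3.sharp (G x) (\<chi> i. Sch x u (E i))"

lemma linear_nth: "linear f \<Longrightarrow> linear (\<lambda>u. f u $ i)" for f :: "real ^ 3 \<Rightarrow> real ^ 3"
  by (rule linear_compose[OF _ bounded_linear.linear[OF bounded_linear_vec_nth], unfolded o_def])

lemma bilinear_Ric: "x \<in> V \<Longrightarrow> bilinear (Ric x)"
  unfolding Ric_def[abs_def]
  by (intro bilinearI linear_compose_sum ballI linear_nth linear_Riem)

lemma linear_mult_left: "linear f \<Longrightarrow> linear (\<lambda>u. c * f u)" for f :: "real ^ 3 \<Rightarrow> real"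
  using linear_compose_scale_right[of f c] by simp

lemma bilinear_Sch: "x \<in> V \<Longrightarrow> bilinear (Sch x)"
  unfolding Sch_def[abs_def]
  by (intro bilinearI linear_compose_sub linear_mult_left
      bilinearD[OF bilinear_Ric] bilinearD[OF bilinear_G])

lemma G_sharp:
  assumes "x \<in> V" "bilinear B"
  shows "G x (inner_product3.sharp (G x) (\<chi> i. B u (E i))) v = B u v"
  by (rule inner_product3.sharp_iff[OF inner_product_G[OF assms(1)] bilinearD(1)[OF assms(2)],
        THEN iffD1, OF refl, rule_format])

lemma Ric_endo: "x \<in> V \<Longrightarrow> G x (Ric_endo x u) v = Ric x u v"
  unfolding Ric_endo_def by (rule G_sharp[OF _ bilinear_Ric])

lemma Sch_endo: "x \<in> V \<Longrightarrow> G x (Sch_endo x u) v = Sch x u v"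
  unfolding Sch_endo_def by (rule G_sharp[OF _ bilinear_Sch])

lemma linear_endo:
  assumes x: "x \<in> V" and B: "bilinear B" and F: "\<And>u v. G x (F u) v = B u v"
  shows "linear F"
proof (rule linearI)
  note eqI = inner_product3.eqI[OF inner_product_G[OF x]]
  show "F (a + b) = F a + F b" for a b
    by (rule eqI) (simp add: G_simps[OF x] F bilinear_ladd[OF B])
  show "F (c *\<^sub>R a) = c *\<^sub>R F a" for c a
    by (rule eqI) (simp add: G_simps[OF x] F bilinear_lmul[OF B])
qed

lemma linear_Ric_endo: "x \<in> V \<Longrightarrow> linear (Ric_endo x)"
  by (rule linear_endo[OF _ bilinear_Ric Ric_endo])

lemma linear_Sch_endo: "x \<in> V \<Longrightarrow> linear (Sch_endo x)"
  by (rule linear_endo[OF _ bilinear_Sch Sch_endo])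

lemma smooth_det_gram: "smooth_on V (\<lambda>x. det (inner_product3.gram (G x)))"
proof (rule smooth_on_cong[OF open_V])
  show "smooth_on V (\<lambda>x. det (\<chi> i j. G x (E i) (E j)))"
    unfolding det_3 by (simp, intro smooth_on_add smooth_on_diff smooth_on_mult smooth_G open_V)
qed (simp add: inner_product3.gram_def[OF inner_product_G])

lemma smooth_sharp:
  assumes l: "\<And>i. smooth_on V (\<lambda>x. l x $ i)"
  shows "smooth_on V (\<lambda>x. inner_product3.sharp (G x) (l x))"
proof (rule smooth_on_vec[OF open_V])
  fix k :: 3
  have "smooth_on V (\<lambda>x. det (\<chi> i j. if j = k then l x $ i else G x (E i) (E j)))"
    using exhaust_3[of k] unfolding det_3
    by (elim disjE) (simp, intro smooth_on_add smooth_on_diff smooth_on_mult smooth_G l open_V)+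
  then have "smooth_on V (\<lambda>x. det (\<chi> i j. if j = k then l x $ i else G x (E i) (E j))
      / det (inner_product3.gram (G x)))"
    using inner_product3.det_gram_pos[OF inner_product_G]
    by (intro smooth_on_divide open_V smooth_det_gram) (auto simp: less_le)
  then show "smooth_on V (\<lambda>x. inner_product3.sharp (G x) (l x) $ k)"
    by (rule smooth_on_cong[OF open_V])
      (simp add: inner_product3.sharp_def[OF inner_product_G] inner_product3.gram_def[OF inner_product_G] if_distrib cong: if_cong)
qed

lemma smooth_Ric: "smooth_on V (\<lambda>x. Ric x u v)"
  unfolding Ric_def by (intro smooth_on_sum smooth_on_nth smooth_Riem open_V) auto

lemma smooth_Ric_endo: "smooth_on V (\<lambda>x. Ric_endo x u)"
  unfolding Ric_endo_def by (rule smooth_sharp) (simp add: smooth_Ric)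

lemma smooth_Scal: "smooth_on V Scal"
  unfolding Scal_def[abs_def] by (intro smooth_on_sum smooth_on_nth smooth_Ric_endo open_V) simp

lemma smooth_Sch_endo: "smooth_on V (\<lambda>x. Sch_endo x u)"
proof -
  have "smooth_on V (\<lambda>x. Sch x u v)" for v
    unfolding Sch_def
    by (intro smooth_on_diff smooth_on_mult smooth_on_divide smooth_Ric smooth_Scal smooth_G smooth_on_const open_V) simp
  then show ?thesis unfolding Sch_endo_def by (intro smooth_sharp) simp
qed

definition Cott_form :: "real ^ 3 \<Rightarrow> real ^ 3 \<Rightarrow> real ^ 3 \<Rightarrow> real ^ 3" where
  "Cott_form x u v = cov (\<lambda>_. u) (\<lambda>y. Sch_endo y v) x - cov (\<lambda>_. v) (\<lambda>y. Sch_endo y u) x"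

text \<open>The Hodge star of the Cotton form, written in the coordinate frame by means of
  \<open>inner_product3.hodge_standard_basis\<close>.\<close>

definition Cott :: "real ^ 3 \<Rightarrow> real ^ 3 \<Rightarrow> real ^ 3 \<Rightarrow> real" where
  "Cott x u v = 1 / sqrt (det (inner_product3.gram (G x)))
    * (\<Sum>c\<in>UNIV. G x u (E c) * G x (Cott_form x (E (c + 1)) (E (c + 2))) v)"

lemma smooth_cov_Sch: "smooth_on V (cov (\<lambda>_. u) (\<lambda>y. Sch_endo y v))"
  by (intro smooth_cov open_V order_refl smooth_on_const smooth_Sch_endo)

lemma smooth_Cott_form: "smooth_on V (\<lambda>x. Cott_form x u v)"
  unfolding Cott_form_def by (intro smooth_on_diff open_V smooth_cov_Sch)

text \<open>The left-hand side is the exterior covariant derivative of the Schouten endomorphism on fields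
  \<open>X, Y\<close> with variable coefficients. The derivatives of these cancel inside each difference, and the
  remaining Christoffel terms cancel between the two because \<open>\<Gamma>\<close> is symmetric.\<close>

lemma Cott_form_tensorial:
  assumes W: "open W" "W \<subseteq> V" "x \<in> W" and X: "smooth_on W X" and Y: "smooth_on W Y"
  shows "(cov X (\<lambda>y. Sch_endo y (Y y)) x - Sch_endo x (cov X Y x))
    - (cov Y (\<lambda>y. Sch_endo y (X y)) x - Sch_endo x (cov Y X x)) = Cott_form x (X x) (Y x)"
proof -
  have x: "x \<in> V" using W by auto
  note lin = linear_Sch_endo[OF x]
  have der: "dderiv (\<lambda>y. Sch_endo y (Z y)) x h = dderiv (\<lambda>y. Sch_endo y (Z x)) x h + Sch_endo x (dderiv Z x h)"
    if "smooth_on W Z" for Z h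
    by (intro dderiv_eqI[OF has_derivative_linear_field[OF open_V x linear_Sch_endo
        smooth_on_differentiable[OF smooth_Sch_endo x] smooth_on_has_derivative[OF that W(3)]]])
  have "Sch_endo x (dderiv X x (Y x) + \<Gamma> x (Y x) (X x)) = Sch_endo x (dderiv X x (Y x)) + Sch_endo x (\<Gamma> x (X x) (Y x))"
    using torsion_free[OF x] by (simp add: linear_add[OF lin])
  then show ?thesis
    by (simp add: Cott_form_def cov_def der[OF X] der[OF Y] linear_add[OF lin])
qed

lemma cov_cong:
  assumes "open W" "x \<in> W" "\<And>y. y \<in> W \<Longrightarrow> Y y = Y' y"
  shows "cov X Y x = cov X Y' x"
  using dderiv_cong_open[of W x Y Y'] assms by (simp add: cov_def)

lemma bilinear_Cott_form:
  assumes x: "x \<in> V"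
  shows "bilinear (Cott_form x)"
proof -
  have c1: "linear (\<lambda>u. cov (\<lambda>_. u) (\<lambda>y. Sch_endo y v) x)" for v
    unfolding cov_def
    by (intro linear_compose_add linear_\<Gamma> x linear_frechet_derivative smooth_on_differentiable[OF smooth_Sch_endo x])
  have "linear (\<lambda>v. dderiv (\<lambda>y. Sch_endo y v) x u)" for u
    by (rule linear_dderiv_field[OF open_V x linear_Sch_endo smooth_Sch_endo])
  then have c2: "linear (\<lambda>v. cov (\<lambda>_. u) (\<lambda>y. Sch_endo y v) x)" for u
    unfolding cov_def
    by (intro linear_compose_add linear_compose[OF linear_Sch_endo[OF x] linear_\<Gamma>(1)[OF x], unfolded o_def])
  show ?thesis
    unfolding Cott_form_def[abs_def] by (intro bilinearI linear_compose_sub c1 c2)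
qed

lemma Cott_form_antisym: "Cott_form x u v = - Cott_form x v u"
  by (simp add: Cott_form_def)

text \<open>The second exterior covariant derivative of the Schouten endomorphism. The constant fields
  commute, so it is the cyclic sum of the curvature applied to that endomorphism, which vanishes by
  \<open>curvature_ricci_cyclic\<close>.\<close>

lemma exterior_derivative_Cott_form:
  assumes x: "x \<in> V"
  shows "(\<Sum>c\<in>UNIV. cov (\<lambda>_. E c) (\<lambda>y. Cott_form y (E (c + 1)) (E (c + 2))) x) = 0"
proof -
  let ?P = "\<lambda>i y. Sch_endo y (E i)"
  let ?N = "\<lambda>i j. cov (\<lambda>_. E i) (?P j)"
  have lin: "cov (\<lambda>_. w) (\<lambda>y. Cott_form y (E i) (E j)) x
      = cov (\<lambda>_. w) (?N i j) x - cov (\<lambda>_. w) (?N j i) x" for w i j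
  proof -
    have "dderiv (\<lambda>y. Cott_form y (E i) (E j)) x w = dderiv (?N i j) x w - dderiv (?N j i) x w"
      unfolding Cott_form_def
      by (intro dderiv_eqI has_derivative_diff smooth_on_has_derivative[OF smooth_cov_Sch x])
    then show ?thesis
      by (simp add: cov_def[of "\<lambda>_. w"] Cott_form_def \<Gamma>_simps[OF x])
  qed
  have R: "cov (\<lambda>_. E i) (?N j k) x - cov (\<lambda>_. E j) (?N i k) x = Riem x (E i) (E j) (?P k x)" for i j k
    using curvature_tensorial[OF open_V order_refl x smooth_on_const smooth_on_const smooth_Sch_endo,
        of "E i" "E j" "E k"]
    by (simp add: cov_def[of "\<lambda>y. 0"] linear_0[OF linear_\<Gamma>(2)[OF x]]
        linear_0[OF linear_frechet_derivative[OF smooth_on_differentiable[OF smooth_Sch_endo x]]])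
  have "Riem x (E 1) (E 2) (?P 3 x) + Riem x (E 2) (E 3) (?P 1 x) + Riem x (E 3) (E 1) (?P 2 x) = 0"
    by (rule inner_product3.curvature_ricci_cyclic[where R="Riem x" and P="Sch_endo x" and s="Scal x / 4",
          OF inner_product_G[OF x] linear_Riem[OF x]
          Riem_antisym Riem_bianchi[OF x] Riem_skew[OF x] linear_Sch_endo[OF x]])
      (simp add: Sch_endo[OF x] Sch_def Ric_def)
  then show ?thesis
    using R[of 1 2 3] R[of 2 3 1] R[of 3 1 2] by (simp add: sum_3 lin algebra_simps)
qed

text \<open>The reciprocal of the Riemannian volume density.\<close>

definition density :: "real ^ 3 \<Rightarrow> real" where
  "density x = 1 / sqrt (det (inner_product3.gram (G x)))"

text \<open>As \<open>\<Gamma>\<close> is symmetric, this is the divergence of the constant vector field \<open>w\<close>.\<close>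

definition trace_\<Gamma> :: "real ^ 3 \<Rightarrow> real ^ 3 \<Rightarrow> real" where
  "trace_\<Gamma> x w = (\<Sum>i\<in>UNIV. \<Gamma> x w (E i) $ i)"

text \<open>The metric is parallel, so the derivative of its Gram matrix along \<open>w\<close> is \<open>C\<^sup>T g + g C\<close> with \<open>C\<close> the
matrix of \<open>\<Gamma> x w\<close>, and the derivative of the determinant is \<open>2 tr C\<close> times the determinant.\<close>

lemma has_derivative_density:
  assumes x: "x \<in> V"
  shows "(density has_derivative (\<lambda>w. - density x * trace_\<Gamma> x w)) (at x)"
proof -
  interpret inner_product3 "G x" by (rule inner_product_G[OF x])
  let ?g = "\<lambda>i j y. G y (E i) (E j)"
  let ?d = "\<lambda>y. det (\<chi> i j. ?g i j y)"
  have g: "(?g i j has_derivative dderiv (?g i j) x) (at x)" for i j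
    by (rule smooth_on_has_derivative[OF smooth_G x])
  have D: "dderiv (?g i j) x w = (\<Sum>k\<in>UNIV. \<Gamma> x w (E i) $ k * ?g k j x)
      + (\<Sum>k\<in>UNIV. \<Gamma> x w (E j) $ k * ?g k i x)" for i j w
    using expand_left[of "\<Gamma> x w (E i)" "E j"] expand_left[of "\<Gamma> x w (E j)" "E i"]
    by (simp add: metric[OF x] sym[of "E i" "\<Gamma> x w (E j)"])
  have s: "?g 2 1 x = ?g 1 2 x" "?g 3 1 x = ?g 1 3 x" "?g 3 2 x = ?g 2 3 x" using sym by auto
  have expand: "?d = (\<lambda>y. ?g 1 1 y * ?g 2 2 y * ?g 3 3 y + ?g 1 2 y * ?g 2 3 y * ?g 3 1 y
      + ?g 1 3 y * ?g 2 1 y * ?g 3 2 y - ?g 1 1 y * ?g 2 3 y * ?g 3 2 y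
      - ?g 1 2 y * ?g 2 1 y * ?g 3 3 y - ?g 1 3 y * ?g 2 2 y * ?g 3 1 y)"
    by (simp add: det_3)
  have d': "(?d has_derivative (\<lambda>w. 2 * trace_\<Gamma> x w * ?d x)) (at x)"
    unfolding expand
    by (rule has_derivative_eq_rhs, (rule has_derivative_add has_derivative_diff has_derivative_mult g)+)
      (simp add: fun_eq_iff det_3 D trace_\<Gamma>_def sum_3 s algebra_simps)
  have pos: "?d x > 0" using det_gram_pos by (simp add: gram_def)
  have "((\<lambda>y. 1 / sqrt (?d y)) has_derivative (\<lambda>w. - (1 / sqrt (?d x)) * trace_\<Gamma> x w)) (at x)"
  proof -
    have "((\<lambda>t. 1 / sqrt t) has_real_derivative - (1 / (2 * ?d x * sqrt (?d x)))) (at (?d x))"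
      using pos by (auto intro!: derivative_eq_intros simp: field_simps power2_eq_square)
    from has_derivative_compose[OF d' this[unfolded has_field_derivative_def]]
    have "((\<lambda>y. 1 / sqrt (?d y)) has_derivative (\<lambda>w. - (1 / (2 * ?d x * sqrt (?d x))) * (2 * trace_\<Gamma> x w * ?d x))) (at x)" .
    then show ?thesis
      by (rule has_derivative_eq_rhs) (use pos in \<open>auto simp: fun_eq_iff\<close>)
  qed
  then have "(density has_derivative (\<lambda>w. - (1 / sqrt (?d x)) * trace_\<Gamma> x w)) (at x)"
    by (rule has_derivative_transform_within_open[OF _ open_V x])
      (simp add: density_def inner_product3.gram_def[OF inner_product_G])
  then show ?thesis by (simp add: density_def gram_def)
qed

lemma differentiable_Cott:
  assumes x: "x \<in> V"
  shows "(\<lambda>y. Cott y u v) differentiable at x"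
proof -
  have "(\<lambda>y. G y u (E c) * G y (Cott_form y (E (c + 1)) (E (c + 2))) v) differentiable at x" for c
    by (intro smooth_on_differentiable[OF _ x] smooth_on_mult open_V smooth_G
        smooth_on_bilinear_field[OF open_V bilinear_G smooth_G] smooth_Cott_form smooth_on_const)
  then have "(\<lambda>y. density y * (\<Sum>c\<in>UNIV. G y u (E c) * G y (Cott_form y (E (c + 1)) (E (c + 2))) v))
      differentiable at x"
    using differentiableI[OF has_derivative_density[OF x]]
    by (intro differentiable_mult differentiable_sum) auto
  then show ?thesis by (simp add: Cott_def density_def)
qed

text \<open>By the product rule the covariant derivative of \<open>Cott\<close> has three parts, from the density, from
\<open>G(u, E\<^sub>c)\<close> and from the Cotton form. After tracing over \<open>S\<close>, the first two are minus and plus the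
divergence of \<open>E\<^sub>c\<close> and cancel; the third is \<open>exterior_derivative_Cott_form\<close>.\<close>

theorem divergence_Cott:
  assumes x: "x \<in> V" and S: "inner_product3.orthonormal (G x) S"
  shows "(\<Sum>i\<in>UNIV. dderiv (\<lambda>y. Cott y (S i) z) x (S i) - Cott x (\<Gamma> x (S i) (S i)) z
    - Cott x (S i) (\<Gamma> x (S i) z)) = 0"
proof -
  interpret inner_product3 "G x" by (rule inner_product_G[OF x])
  define D where "D c y = Cott_form y (E (c + 1)) (E (c + 2))" for c y
  have Cott: "Cott y u v = density y * (\<Sum>c\<in>UNIV. G y u (E c) * G y (D c y) v)" for y u v
    by (simp add: Cott_def density_def D_def)
  have D: "(D c has_derivative dderiv (D c) x) (at x)" for c
    unfolding D_def by (rule smooth_on_has_derivative[OF smooth_Cott_form x])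
  have C: "((\<lambda>y. c) has_derivative (\<lambda>h. 0)) (at x)" for c :: "real ^ 3"
    by (rule has_derivative_const)
  let ?\<mu> = "density x"
  \<comment> \<open>the product rule puts \<open>\<Gamma> x h\<close> in front of \<open>u\<close> and \<open>z\<close>; the subtracted terms on the left remove it\<close>
  have step: "dderiv (\<lambda>y. Cott y u z) x h - Cott x (\<Gamma> x h u) z - Cott x u (\<Gamma> x h z)
      = ?\<mu> * (\<Sum>c\<in>UNIV. - trace_\<Gamma> x h * G x u (E c) * G x (D c x) z
          + G x u (\<Gamma> x h (E c)) * G x (D c x) z + G x u (E c) * G x (cov (\<lambda>_. h) (D c) x) z)" for u h
  proof -
    have "((\<lambda>y. Cott y u z) has_derivative (\<lambda>h. ?\<mu> * (\<Sum>c\<in>UNIV.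
          G x u (E c) * (G x (dderiv (D c) x h + \<Gamma> x h (D c x)) z + G x (D c x) (0 + \<Gamma> x h z))
        + (G x (0 + \<Gamma> x h u) (E c) + G x u (0 + \<Gamma> x h (E c))) * G x (D c x) z)
        + (- ?\<mu> * trace_\<Gamma> x h) * (\<Sum>c\<in>UNIV. G x u (E c) * G x (D c x) z))) (at x)"
      unfolding Cott
      by (rule has_derivative_mult has_derivative_density[OF x] has_derivative_sum dderiv_G_field[OF x] C D)+
    from dderiv_eqI[OF this, of h] show ?thesis
      by (simp add: Cott cov_def sum_3 algebra_simps)
  qed
  have ex: "w = (\<Sum>i\<in>UNIV. G x (S i) w *\<^sub>R S i)" for w
    using orthonormal_expansion[OF S, of w] by (simp only: sym[of w])
  have t1: "(\<Sum>i\<in>UNIV. trace_\<Gamma> x (S i) * G x (S i) (E c)) = trace_\<Gamma> x (E c)" for c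
  proof -
    have lin: "linear (trace_\<Gamma> x)"
      unfolding trace_\<Gamma>_def[abs_def] by (intro linear_compose_sum ballI linear_nth linear_\<Gamma> x)
    have "trace_\<Gamma> x (E c) = trace_\<Gamma> x (\<Sum>i\<in>UNIV. G x (S i) (E c) *\<^sub>R S i)" by (rule arg_cong[OF ex])
    then show ?thesis by (simp add: linear_sum[OF lin] linear_cmul[OF lin] mult.commute)
  qed
  have t2: "(\<Sum>i\<in>UNIV. G x (S i) (\<Gamma> x (S i) (E c))) = trace_\<Gamma> x (E c)" for c
    unfolding trace_\<Gamma>_def orthonormal_trace[OF S linear_\<Gamma>(1)[OF x]]
    using torsion_free[OF x] by (intro sum.cong refl) (simp add: sym[of "S _"])
  have t3: "(\<Sum>i\<in>UNIV. G x (S i) (E c) * G x (cov (\<lambda>_. S i) (D c) x) z) = G x (cov (\<lambda>_. E c) (D c) x) z" for c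
  proof -
    have lin: "linear (\<lambda>w. G x (cov (\<lambda>_. w) (D c) x) z)"
    proof -
      have "linear (\<lambda>w. cov (\<lambda>_. w) (D c) x)"
        unfolding cov_def
        by (intro linear_compose_add linear_\<Gamma> x linear_frechet_derivative differentiableI[OF D])
      from linear_compose[OF this bilinearD(2)[OF bilinear]] show ?thesis by (simp add: o_def)
    qed
    have "G x (cov (\<lambda>_. E c) (D c) x) z = (\<lambda>w. G x (cov (\<lambda>_. w) (D c) x) z) (\<Sum>i\<in>UNIV. G x (S i) (E c) *\<^sub>R S i)"
      using arg_cong[OF ex[of "E c"], of "\<lambda>w. G x (cov (\<lambda>_. w) (D c) x) z"] .
    then show ?thesis by (simp only: linear_sum[OF lin] linear_cmul[OF lin] real_scaleR_def)
  qed
  have "(\<Sum>i\<in>UNIV. dderiv (\<lambda>y. Cott y (S i) z) x (S i) - Cott x (\<Gamma> x (S i) (S i)) z - Cott x (S i) (\<Gamma> x (S i) z))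
      = ?\<mu> * (\<Sum>c\<in>UNIV. - (\<Sum>i\<in>UNIV. trace_\<Gamma> x (S i) * G x (S i) (E c)) * G x (D c x) z
          + (\<Sum>i\<in>UNIV. G x (S i) (\<Gamma> x (S i) (E c))) * G x (D c x) z
          + (\<Sum>i\<in>UNIV. G x (S i) (E c) * G x (cov (\<lambda>_. S i) (D c) x) z))"
    unfolding step by (simp add: sum_3 algebra_simps)
  also have "\<dots> = ?\<mu> * (\<Sum>c\<in>UNIV. G x (cov (\<lambda>_. E c) (D c) x) z)"
    unfolding t1 t2 t3 by simp
  also have "\<dots> = ?\<mu> * G x (\<Sum>c\<in>UNIV. cov (\<lambda>_. E c) (D c) x) z" by (simp only: sum_left)
  also have "\<dots> = 0"
    using exterior_derivative_Cott_form[OF x] unfolding D_def by (simp add: zero_left)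
  finally show ?thesis .
qed

end


section \<open>Charts, tangent vectors and smooth fields\<close>

locale smooth_atlas3 =
  fixes M :: "'a topology" and A :: "'a chart set"
  assumes manifold: "oriented_smooth_3manifold M A"
begin

lemma dom_open: "\<kappa> \<in> A \<Longrightarrow> openin M (dom_ch \<kappa>)"
  using manifold by (auto simp: oriented_smooth_3manifold_def is_chart_def)

lemma chart_homeomorphic: "\<kappa> \<in> A \<Longrightarrow>
    homeomorphic_map (subtopology M (dom_ch \<kappa>)) (top_of_set (coord \<kappa> ` dom_ch \<kappa>)) (coord \<kappa>)"
  using manifold by (auto simp: oriented_smooth_3manifold_def is_chart_def)

lemma inj_coord: "\<kappa> \<in> A \<Longrightarrow> inj_on (coord \<kappa>) (dom_ch \<kappa>)"
  using homeomorphic_imp_injective_map[OF chart_homeomorphic] openin_subset[OF dom_open]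
  by (simp add: Int_absorb1)

lemma param_coord [simp]: "\<kappa> \<in> A \<Longrightarrow> q \<in> dom_ch \<kappa> \<Longrightarrow> param \<kappa> (coord \<kappa> q) = q"
  unfolding param_def by (rule inv_into_f_f[OF inj_coord])

lemma param_image:
  assumes "\<kappa> \<in> A" "W \<subseteq> dom_ch \<kappa>" "x \<in> coord \<kappa> ` W"
  shows "param \<kappa> x \<in> W" "coord \<kappa> (param \<kappa> x) = x"
  using assms by auto

lemma open_coord_image:
  assumes "\<kappa> \<in> A" "openin M W" "W \<subseteq> dom_ch \<kappa>"
  shows "open (coord \<kappa> ` W)"
proof -
  have "openin (subtopology M (dom_ch \<kappa>)) W" 
    using openin_open_subtopology[OF dom_open[OF assms(1)]] assms by blast
  then have "openin (top_of_set (coord \<kappa> ` dom_ch \<kappa>)) (coord \<kappa> ` W)"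
    using homeomorphic_imp_open_map[OF chart_homeomorphic[OF assms(1)]] by (simp add: open_map_def)
  moreover have "open (coord \<kappa> ` dom_ch \<kappa>)"
    using manifold assms(1) by (auto simp: oriented_smooth_3manifold_def is_chart_def)
  ultimately show ?thesis using openin_open_trans by blast
qed

lemma open_overlap: "\<kappa> \<in> A \<Longrightarrow> \<kappa>' \<in> A \<Longrightarrow> openin M W \<Longrightarrow> open (coord \<kappa> ` (W \<inter> dom_ch \<kappa>))"
  by (intro open_coord_image openin_Int dom_open) auto

lemma smooth_transition: "\<kappa> \<in> A \<Longrightarrow> \<kappa>' \<in> A \<Longrightarrow>
    smooth_on (coord \<kappa> ` (dom_ch \<kappa> \<inter> dom_ch \<kappa>')) (\<lambda>x. coord \<kappa>' (param \<kappa> x))"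
  using manifold by (simp add: oriented_smooth_3manifold_def o_def)

lemma has_derivative_transition:
  assumes "\<kappa> \<in> A" "\<kappa>' \<in> A" "q \<in> dom_ch \<kappa>" "q \<in> dom_ch \<kappa>'"
  shows "((\<lambda>x. coord \<kappa>' (param \<kappa> x)) has_derivative jac \<kappa> \<kappa>' q) (at (coord \<kappa> q))"
  unfolding jac_def o_def using assms by (intro smooth_on_has_derivative[OF smooth_transition]) auto

lemma linear_jac: "\<kappa> \<in> A \<Longrightarrow> \<kappa>' \<in> A \<Longrightarrow> q \<in> dom_ch \<kappa> \<Longrightarrow> q \<in> dom_ch \<kappa>' \<Longrightarrow> linear (jac \<kappa> \<kappa>' q)"
  by (rule has_derivative_linear[OF has_derivative_transition])

lemma jac_self:
  assumes "\<kappa> \<in> A" "q \<in> dom_ch \<kappa>"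
  shows "jac \<kappa> \<kappa> q u = u"
proof -
  have "((\<lambda>x. coord \<kappa> (param \<kappa> x)) has_derivative (\<lambda>u. u)) (at (coord \<kappa> q))"
    by (rule has_derivative_transform_within_open[OF has_derivative_ident
          open_coord_image[OF assms(1) dom_open[OF assms(1)] order_refl]]) (use assms in auto)
  then show ?thesis using has_derivative_unique[OF has_derivative_transition[OF assms(1,1) assms(2,2)]] by metis
qed

lemma jac_cocycle:
  assumes "\<kappa> \<in> A" "\<kappa>' \<in> A" "\<kappa>'' \<in> A" "q \<in> dom_ch \<kappa>" "q \<in> dom_ch \<kappa>'" "q \<in> dom_ch \<kappa>''"
  shows "jac \<kappa>' \<kappa>'' q (jac \<kappa> \<kappa>' q u) = jac \<kappa> \<kappa>'' q u"
proof -
  have "((\<lambda>x. coord \<kappa>'' (param \<kappa>' x)) has_derivative jac \<kappa>' \<kappa>'' q) (at (coord \<kappa>' (param \<kappa> (coord \<kappa> q))))"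
    using has_derivative_transition[OF assms(2,3,5,6)] assms by simp
  from has_derivative_compose[OF has_derivative_transition[OF assms(1,2,4,5)] this]
  have "((\<lambda>x. coord \<kappa>'' (param \<kappa>' (coord \<kappa>' (param \<kappa> x)))) has_derivative
      (\<lambda>u. jac \<kappa>' \<kappa>'' q (jac \<kappa> \<kappa>' q u))) (at (coord \<kappa> q))" .
  then have "((\<lambda>x. coord \<kappa>'' (param \<kappa> x)) has_derivative (\<lambda>u. jac \<kappa>' \<kappa>'' q (jac \<kappa> \<kappa>' q u))) (at (coord \<kappa> q))"
    by (rule has_derivative_transform_within_open[OF _ open_overlap[OF assms(1,2) dom_open[OF assms(2)]]])
      (use assms in auto)
  from has_derivative_unique[OF this has_derivative_transition[OF assms(1,3,4,6)]] show ?thesis by metis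
qed

lemma tvec_of_apply [simp]: "\<kappa> \<in> A \<Longrightarrow> q \<in> dom_ch \<kappa> \<Longrightarrow> tvec_of A q \<kappa> u \<kappa> = u"
  by (simp add: tvec_of_def jac_self)

lemma tangent_apply_jac:
  assumes "\<kappa> \<in> A" "\<kappa>' \<in> A" "q \<in> dom_ch \<kappa>" "q \<in> dom_ch \<kappa>'" "v \<in> tangent_space A q"
  shows "v \<kappa>' = jac \<kappa> \<kappa>' q (v \<kappa>)"
  using assms unfolding tangent_space_def by blast

lemma tangent_spaceI:
  assumes "\<And>\<kappa>. \<not> (\<kappa> \<in> A \<and> q \<in> dom_ch \<kappa>) \<Longrightarrow> v \<kappa> = 0"
    and "\<And>\<kappa> \<kappa>'. \<kappa> \<in> A \<Longrightarrow> \<kappa>' \<in> A \<Longrightarrow> q \<in> dom_ch \<kappa> \<Longrightarrow> q \<in> dom_ch \<kappa>' \<Longrightarrow> v \<kappa>' = jac \<kappa> \<kappa>' q (v \<kappa>)"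
  shows "v \<in> tangent_space A q"
  using assms unfolding tangent_space_def by blast

lemma tangent_apply_zero: "v \<in> tangent_space A q \<Longrightarrow> \<not> (\<kappa> \<in> A \<and> q \<in> dom_ch \<kappa>) \<Longrightarrow> v \<kappa> = 0"
  unfolding tangent_space_def by blast

lemma tvec_of_in_tangent_space:
  assumes "\<kappa> \<in> A" "q \<in> dom_ch \<kappa>"
  shows "tvec_of A q \<kappa> u \<in> tangent_space A q"
  by (rule tangent_spaceI) (auto simp: tvec_of_def jac_cocycle[OF assms(1) _ _ assms(2)])

lemma tangent_eqI:
  assumes "\<kappa> \<in> A" "q \<in> dom_ch \<kappa>" "v \<in> tangent_space A q" "w \<in> tangent_space A q" "v \<kappa> = w \<kappa>"
  shows "v = w"
proof
  fix \<kappa>'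
  show "v \<kappa>' = w \<kappa>'"
  proof (cases "\<kappa>' \<in> A \<and> q \<in> dom_ch \<kappa>'")
    case True
    then show ?thesis using tangent_apply_jac[OF assms(1) _ assms(2)] assms(3-5) by metis
  next
    case False
    then show ?thesis using tangent_apply_zero assms(3,4) by metis
  qed
qed

lemma tvec_of_coords: "\<kappa> \<in> A \<Longrightarrow> q \<in> dom_ch \<kappa> \<Longrightarrow> v \<in> tangent_space A q \<Longrightarrow> tvec_of A q \<kappa> (v \<kappa>) = v"
  by (rule tangent_eqI) (auto simp: tvec_of_in_tangent_space)

lemma tangent_add:
  assumes "v \<in> tangent_space A q" "w \<in> tangent_space A q"
  shows "v + w \<in> tangent_space A q"
proof (rule tangent_spaceI)
  fix \<kappa> \<kappa>' assume a: "\<kappa> \<in> A" "\<kappa>' \<in> A" "q \<in> dom_ch \<kappa>" "q \<in> dom_ch \<kappa>'"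
  show "(v + w) \<kappa>' = jac \<kappa> \<kappa>' q ((v + w) \<kappa>)"
    using tangent_apply_jac[OF a assms(1)] tangent_apply_jac[OF a assms(2)] linear_add[OF linear_jac[OF a]] by (simp add: tscale_def)
qed (simp add: tangent_apply_zero[OF assms(1)] tangent_apply_zero[OF assms(2)])

lemma tangent_diff:
  assumes "v \<in> tangent_space A q" "w \<in> tangent_space A q"
  shows "v - w \<in> tangent_space A q"
proof (rule tangent_spaceI)
  fix \<kappa> \<kappa>' assume a: "\<kappa> \<in> A" "\<kappa>' \<in> A" "q \<in> dom_ch \<kappa>" "q \<in> dom_ch \<kappa>'"
  show "(v - w) \<kappa>' = jac \<kappa> \<kappa>' q ((v - w) \<kappa>)"
    using tangent_apply_jac[OF a assms(1)] tangent_apply_jac[OF a assms(2)] linear_diff[OF linear_jac[OF a]] by (simp add: tscale_def)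
qed (simp add: tangent_apply_zero[OF assms(1)] tangent_apply_zero[OF assms(2)])

lemma tangent_scale:
  assumes "v \<in> tangent_space A q"
  shows "c \<odot> v \<in> tangent_space A q"
proof (rule tangent_spaceI)
  fix \<kappa> \<kappa>' assume a: "\<kappa> \<in> A" "\<kappa>' \<in> A" "q \<in> dom_ch \<kappa>" "q \<in> dom_ch \<kappa>'"
  show "(c \<odot> v) \<kappa>' = jac \<kappa> \<kappa>' q ((c \<odot> v) \<kappa>)"
    using tangent_apply_jac[OF a assms] linear_cmul[OF linear_jac[OF a]] by (simp add: tscale_def)
qed (simp add: tangent_apply_zero[OF assms] tscale_def)

lemma tvec_of_add: "\<kappa> \<in> A \<Longrightarrow> q \<in> dom_ch \<kappa> \<Longrightarrow> tvec_of A q \<kappa> (u + w) = tvec_of A q \<kappa> u + tvec_of A q \<kappa> w"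
  by (auto simp: tvec_of_def fun_eq_iff linear_add[OF linear_jac])

lemma tvec_of_scale: "\<kappa> \<in> A \<Longrightarrow> q \<in> dom_ch \<kappa> \<Longrightarrow> tvec_of A q \<kappa> (c *\<^sub>R u) = c \<odot> tvec_of A q \<kappa> u"
  by (auto simp: tvec_of_def tscale_def fun_eq_iff linear_cmul[OF linear_jac])

lemma chart_at:
  assumes "q \<in> topspace M"
  shows "chart_at A q \<in> A" "q \<in> dom_ch (chart_at A q)"
proof -
  have "\<exists>\<kappa>. \<kappa> \<in> A \<and> q \<in> dom_ch \<kappa>" 
    using manifold assms unfolding oriented_smooth_3manifold_def by blast
  from someI_ex[OF this] show "chart_at A q \<in> A" "q \<in> dom_ch (chart_at A q)" by (auto simp: chart_at_def)
qed

lemma dom_subset_topspace: "\<kappa> \<in> A \<Longrightarrow> q \<in> dom_ch \<kappa> \<Longrightarrow> q \<in> topspace M"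
  using openin_subset[OF dom_open] by blast

text \<open>Smoothness is demanded in all charts, but the transition maps are smooth, so on a subset of one
chart domain it suffices to check it there; similarly for vector fields.\<close>

lemma smooth_fun_chartI:
  assumes "\<kappa> \<in> A" "openin M W" "W \<subseteq> dom_ch \<kappa>" "smooth_on (coord \<kappa> ` W) (\<lambda>x. f (param \<kappa> x))"
  shows "smooth_fun A W f"
  unfolding smooth_fun_def o_def
proof
  fix \<kappa>' assume \<kappa>': "\<kappa>' \<in> A"
  let ?S = "coord \<kappa>' ` (W \<inter> dom_ch \<kappa>')"
  have S: "open ?S" by (rule open_overlap[OF \<kappa>' assms(1,2)])
  have "smooth_on ?S (\<lambda>x. f (param \<kappa> (coord \<kappa> (param \<kappa>' x))))"
  proof (rule smooth_on_compose[OF S open_coord_image[OF assms(1-3)] _ _ assms(4)])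
    show "smooth_on ?S (\<lambda>x. coord \<kappa> (param \<kappa>' x))"
      by (rule smooth_on_subset[OF smooth_transition[OF \<kappa>' assms(1)]]) (use assms(3) in auto)
  qed (use \<kappa>' in auto)
  then show "smooth_on ?S (\<lambda>x. f (param \<kappa>' x))"
    by (rule smooth_on_cong[OF S]) (use \<kappa>' assms in auto)
qed

lemma smooth_vfield_chartI:
  assumes "\<kappa> \<in> A" "openin M W" "W \<subseteq> dom_ch \<kappa>" "\<And>q. q \<in> W \<Longrightarrow> Y q \<in> tangent_space A q"
    "smooth_on (coord \<kappa> ` W) (\<lambda>x. Y (param \<kappa> x) \<kappa>)"
  shows "smooth_vfield A W Y"
  unfolding smooth_vfield_def
proof (intro conjI ballI)
  fix \<kappa>' assume \<kappa>': "\<kappa>' \<in> A"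
  let ?S = "coord \<kappa>' ` (W \<inter> dom_ch \<kappa>')" and ?T = "coord \<kappa> ` (W \<inter> dom_ch \<kappa>')"
  have S: "open ?S" by (rule open_overlap[OF \<kappa>' assms(1,2)])
  have T: "open ?T" by (rule open_coord_image[OF assms(1) openin_Int[OF assms(2) dom_open[OF \<kappa>']]]) (use assms in auto)
  have tr: "smooth_on ?T (\<lambda>x. coord \<kappa>' (param \<kappa> x))"
    by (rule smooth_on_subset[OF smooth_transition[OF assms(1) \<kappa>']]) (use assms(3) in auto)
  have Yc: "smooth_on ?T (\<lambda>x. Y (param \<kappa> x) \<kappa>)" by (rule smooth_on_subset[OF assms(5)]) auto
  have "smooth_on ?T (\<lambda>x. dderiv (\<lambda>x. coord \<kappa>' (param \<kappa> x)) x (Y (param \<kappa> x) \<kappa>))"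
    by (rule smooth_on_linear_field[OF T, where L="dderiv (\<lambda>x. coord \<kappa>' (param \<kappa> x))"])
      (use tr Yc in
        \<open>auto intro: smooth_on_dderiv linear_frechet_derivative smooth_on_differentiable\<close>)
  then have "smooth_on ?T (\<lambda>x. Y (param \<kappa> x) \<kappa>')"
  proof (rule smooth_on_cong[OF T])
    fix x assume "x \<in> ?T"
    then obtain q where q: "q \<in> W" "q \<in> dom_ch \<kappa>'" "q \<in> dom_ch \<kappa>" "x = coord \<kappa> q" using assms(3) by auto
    then show "dderiv (\<lambda>x. coord \<kappa>' (param \<kappa> x)) x (Y (param \<kappa> x) \<kappa>) = Y (param \<kappa> x) \<kappa>'"
      using tangent_apply_jac[OF assms(1) \<kappa>' q(3,2) assms(4)[OF q(1)]] assms(1) by (simp add: jac_def o_def)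
  qed
  then have "smooth_on ?S (\<lambda>x. Y (param \<kappa> (coord \<kappa> (param \<kappa>' x))) \<kappa>')"
  proof (rule smooth_on_compose[OF S T, rotated 2])
    show "smooth_on ?S (\<lambda>x. coord \<kappa> (param \<kappa>' x))"
      by (rule smooth_on_subset[OF smooth_transition[OF \<kappa>' assms(1)]]) (use assms(3) in auto)
  qed (use \<kappa>' in auto)
  then show "smooth_on ?S (\<lambda>x. Y (param \<kappa>' x) \<kappa>')"
    by (rule smooth_on_cong[OF S]) (use \<kappa>' assms in auto)
qed (use assms(4) in auto)

lemma smooth_vfield_tangent: "smooth_vfield A W Y \<Longrightarrow> q \<in> W \<Longrightarrow> Y q \<in> tangent_space A q"
  by (simp add: smooth_vfield_def)

lemma smooth_vfield_coords:
  "smooth_vfield A W Y \<Longrightarrow> \<kappa> \<in> A \<Longrightarrow> W \<subseteq> dom_ch \<kappa> \<Longrightarrow> smooth_on (coord \<kappa> ` W) (\<lambda>x. Y (param \<kappa> x) \<kappa>)"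
  by (auto simp: smooth_vfield_def Int_absorb2)

text \<open>The chain rule makes the derivative along a tangent vector independent of the chart.\<close>

lemma tderiv_chart:
  assumes "\<kappa> \<in> A" "q \<in> dom_ch \<kappa>" "v \<in> tangent_space A q"
    and f: "(\<lambda>x. f (param \<kappa> x)) differentiable at (coord \<kappa> q)"
  shows "tderiv A q v f = dderiv (\<lambda>x. f (param \<kappa> x)) (coord \<kappa> q) (v \<kappa>)"
proof -
  define \<kappa>' where "\<kappa>' = chart_at A q"
  have \<kappa>': "\<kappa>' \<in> A" "q \<in> dom_ch \<kappa>'"
    using chart_at[OF dom_subset_topspace[OF assms(1,2)]] by (auto simp: \<kappa>'_def)
  have "((\<lambda>x. f (param \<kappa> x)) has_derivative dderiv (\<lambda>x. f (param \<kappa> x)) (coord \<kappa> q))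
      (at (coord \<kappa> (param \<kappa>' (coord \<kappa>' q))))"
    using has_derivative_dderiv[OF f] \<kappa>' by simp
  from has_derivative_compose[OF has_derivative_transition[OF \<kappa>'(1) assms(1) \<kappa>'(2) assms(2)] this]
  have "((\<lambda>x. f (param \<kappa> (coord \<kappa> (param \<kappa>' x)))) has_derivative
      (\<lambda>u. dderiv (\<lambda>x. f (param \<kappa> x)) (coord \<kappa> q) (jac \<kappa>' \<kappa> q u))) (at (coord \<kappa>' q))" .
  then have "((\<lambda>x. f (param \<kappa>' x)) has_derivative
      (\<lambda>u. dderiv (\<lambda>x. f (param \<kappa> x)) (coord \<kappa> q) (jac \<kappa>' \<kappa> q u))) (at (coord \<kappa>' q))"
    by (rule has_derivative_transform_within_open[OF _ open_overlap[OF \<kappa>'(1) assms(1) dom_open[OF assms(1)]]])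
      (use assms \<kappa>' in auto)
  from dderiv_eqI[OF this, of "v \<kappa>'"] show ?thesis
    using tangent_apply_jac[OF \<kappa>'(1) assms(1) \<kappa>'(2) assms(2,3)]
    by (simp add: tderiv_def Let_def \<kappa>'_def[symmetric] o_def)
qed

text \<open>A change of charts conjugates the matrix of an endomorphism by the Jacobian.\<close>

lemma tangent_trace_chart:
  assumes "\<kappa> \<in> A" "q \<in> dom_ch \<kappa>"
    and L: "\<And>v. v \<in> tangent_space A q \<Longrightarrow> L v \<in> tangent_space A q"
    and l: "\<And>v. v \<in> tangent_space A q \<Longrightarrow> L v \<kappa> = l (v \<kappa>)" "linear l"
  shows "tangent_trace A q L = (\<Sum>i\<in>UNIV. l (axis i 1) $ i)"
proof -
  define \<kappa>' where "\<kappa>' = chart_at A q"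
  have \<kappa>': "\<kappa>' \<in> A" "q \<in> dom_ch \<kappa>'"
    using chart_at[OF dom_subset_topspace[OF assms(1,2)]] by (auto simp: \<kappa>'_def)
  let ?J = "jac \<kappa> \<kappa>' q" and ?K = "jac \<kappa>' \<kappa> q"
  have lin: "linear ?J" "linear ?K" using linear_jac assms \<kappa>' by auto
  have "L (tvec_of A q \<kappa>' u) \<kappa>' = ?J (l (?K u))" for u
  proof -
    have t: "tvec_of A q \<kappa>' u \<in> tangent_space A q" using tvec_of_in_tangent_space \<kappa>' by auto
    have "L (tvec_of A q \<kappa>' u) \<kappa>' = ?J (L (tvec_of A q \<kappa>' u) \<kappa>)"
      by (rule tangent_apply_jac[OF assms(1) \<kappa>'(1) assms(2) \<kappa>'(2) L[OF t]])
    also have "L (tvec_of A q \<kappa>' u) \<kappa> = l (?K u)"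
      using l(1)[OF t] tangent_apply_jac[OF \<kappa>'(1) assms(1) \<kappa>'(2) assms(2) t] \<kappa>' by simp
    finally show ?thesis .
  qed
  then have "tangent_trace A q L = trace (matrix (?J \<circ> (l \<circ> ?K)))"
    by (simp add: tangent_trace_def Let_def \<kappa>'_def[symmetric] o_def)
  also have "\<dots> = trace (matrix ?J ** (matrix l ** matrix ?K))"
    by (simp add: matrix_compose linear_compose lin l(2))
  also have "\<dots> = trace ((matrix l ** matrix ?K) ** matrix ?J)"
    by (rule trace_mul_sym)
  also have "\<dots> = trace (matrix l ** matrix (?K \<circ> ?J))"
    by (simp add: matrix_compose lin matrix_mul_assoc)
  also have "?K \<circ> ?J = (\<lambda>u. u)"
    using jac_cocycle[OF assms(1) \<kappa>'(1) assms(1) assms(2) \<kappa>'(2) assms(2)] jac_self[OF assms(1,2)] by auto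
  also have "matrix l ** matrix (\<lambda>u. u) = matrix l"
    using matrix_id_mat_1 by (metis id_def matrix_mul_rid eq_id_iff)
  finally show ?thesis by (simp add: trace_def matrix_def)
qed

lemma smooth_constant_field:
  assumes "\<kappa> \<in> A" "openin M W" "W \<subseteq> dom_ch \<kappa>"
  shows "smooth_vfield A W (\<lambda>q. tvec_of A q \<kappa> u)"
proof (rule smooth_vfield_chartI[OF assms])
  show "smooth_on (coord \<kappa> ` W) (\<lambda>x. tvec_of A (param \<kappa> x) \<kappa> u \<kappa>)"
    by (rule smooth_on_cong[OF open_coord_image[OF assms] smooth_on_const[of _ u]]) (use assms in auto)
qed (use tvec_of_in_tangent_space[OF assms(1)] assms(3) in blast)

lemma smooth_ext:
  "q \<in> topspace M \<Longrightarrow> openin M W \<Longrightarrow> W \<subseteq> dom_ch (chart_at A q) \<Longrightarrow> smooth_vfield A W (ext A q v)"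
  unfolding ext_def by (intro smooth_constant_field chart_at)

lemma ext_at: "q \<in> topspace M \<Longrightarrow> v \<in> tangent_space A q \<Longrightarrow> ext A q v q = v"
  unfolding ext_def by (intro tvec_of_coords chart_at)

end


section \<open>The Levi-Civita connection in a chart\<close>

locale riemannian_chart = smooth_atlas3 M A
  for M :: "'a topology" and A :: "'a chart set" +
  fixes g :: "'a bilin" and nabla :: "'a conn" and \<kappa> :: "'a chart"
  assumes riemannian: "riemannian_metric M A g"
    and levi_civita: "levi_civita M A g nabla"
    and chart: "\<kappa> \<in> A"
begin

abbreviation U :: "'a set" where "U \<equiv> dom_ch \<kappa>"
abbreviation V :: "(real ^ 3) set" where "V \<equiv> coord \<kappa> ` U"

text \<open>The vector field with constant coefficients \<open>u\<close> in the chart; off \<open>U\<close> its values are arbitrary.\<close>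

definition cfield :: "real ^ 3 \<Rightarrow> 'a vfield" where
  "cfield u = (\<lambda>q. tvec_of A q \<kappa> u)"

abbreviation coords :: "'a vfield \<Rightarrow> real ^ 3 \<Rightarrow> real ^ 3" where
  "coords Y \<equiv> \<lambda>x. Y (param \<kappa> x) \<kappa>"

lemmas U_open = dom_open[OF chart]

lemma connection: "affine_connection M A nabla"
  using levi_civita by (simp add: levi_civita_def)

lemma cfield_tangent: "q \<in> U \<Longrightarrow> cfield u q \<in> tangent_space A q"
  unfolding cfield_def by (rule tvec_of_in_tangent_space[OF chart])

lemma cfield_apply [simp]: "q \<in> U \<Longrightarrow> cfield u q \<kappa> = u"
  unfolding cfield_def by (rule tvec_of_apply[OF chart])

lemma cfield_coords: "q \<in> U \<Longrightarrow> v \<in> tangent_space A q \<Longrightarrow> cfield (v \<kappa>) q = v"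
  unfolding cfield_def by (rule tvec_of_coords[OF chart])

lemma cfield_add: "q \<in> U \<Longrightarrow> cfield (u + w) q = cfield u q + cfield w q"
  unfolding cfield_def by (rule tvec_of_add[OF chart])

lemma cfield_scale: "q \<in> U \<Longrightarrow> cfield (c *\<^sub>R u) q = c \<odot> cfield u q"
  unfolding cfield_def by (rule tvec_of_scale[OF chart])

lemma eqI: "q \<in> U \<Longrightarrow> v \<in> tangent_space A q \<Longrightarrow> w \<in> tangent_space A q \<Longrightarrow> v \<kappa> = w \<kappa> \<Longrightarrow> v = w"
  by (rule tangent_eqI[OF chart])

lemma coords_simps [simp]: "q \<in> U \<Longrightarrow> param \<kappa> (coord \<kappa> q) = q"
  by (rule param_coord[OF chart])

lemma smooth_vec: "openin M W \<Longrightarrow> W \<subseteq> U \<Longrightarrow> smooth_vfield A W (cfield u)"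
  unfolding cfield_def by (rule smooth_constant_field[OF chart])

lemma smooth_coords: "smooth_vfield A W Y \<Longrightarrow> W \<subseteq> U \<Longrightarrow> smooth_on (coord \<kappa> ` W) (coords Y)"
  by (rule smooth_vfield_coords[OF _ chart])

lemma smooth_funI: "openin M W \<Longrightarrow> W \<subseteq> U \<Longrightarrow> smooth_on (coord \<kappa> ` W) (\<lambda>x. f (param \<kappa> x)) \<Longrightarrow> smooth_fun A W f"
  by (rule smooth_fun_chartI[OF chart])

lemma smooth_vfieldI:
  assumes "openin M W" "W \<subseteq> U" "\<And>q. q \<in> W \<Longrightarrow> Y q \<in> tangent_space A q"
    and "smooth_on (coord \<kappa> ` W) y" "\<And>q. q \<in> W \<Longrightarrow> Y q \<kappa> = y (coord \<kappa> q)"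
  shows "smooth_vfield A W Y"
  by (rule smooth_vfield_chartI[OF chart assms(1-3)])
    (use assms in \<open>auto intro!: smooth_on_cong[OF open_coord_image[OF chart assms(1,2)] assms(4)]\<close>)

lemma nabla_smooth:
  "openin M W \<Longrightarrow> smooth_vfield A W Y \<Longrightarrow> smooth_vfield A W Z \<Longrightarrow> smooth_vfield A W (nabla Y Z)"
  using connection unfolding affine_connection_def by blast

lemma nabla_add:
  assumes "openin M W" "smooth_vfield A W Y" "smooth_vfield A W Z" "smooth_vfield A W X" "p \<in> W"
  shows "nabla (Y + X) Z p = nabla Y Z p + nabla X Z p" "nabla Y (Z + X) p = nabla Y Z p + nabla Y X p"
  using connection assms unfolding affine_connection_def by blast+

lemma nabla_scale:
  assumes "openin M W" "smooth_vfield A W Y" "smooth_vfield A W Z" "smooth_fun A W f" "p \<in> W"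
  shows "nabla (\<lambda>q. f q \<odot> Y q) Z p = f p \<odot> nabla Y Z p"
    "nabla Y (\<lambda>q. f q \<odot> Z q) p = tderiv A p (Y p) f \<odot> Z p + f p \<odot> nabla Y Z p"
  using connection assms unfolding affine_connection_def by blast+

lemma tscale_simps [simp]: "1 \<odot> v = v" "0 \<odot> v = 0" "(c \<odot> v) \<kappa>' = c *\<^sub>R v \<kappa>'"
  by (auto simp: tscale_def fun_eq_iff)

text \<open>Locality of the connection: multiplying by the indicator of an open set, a smooth function
  there, does not change the values on this set but removes all information off it.\<close>

lemma nabla_cong:
  assumes W: "openin M W" "W \<subseteq> U" "p \<in> W" and X: "smooth_vfield A W X" "smooth_vfield A W X'"
    and Y: "smooth_vfield A W Y" "smooth_vfield A W Y'"
    and eq: "\<And>q. q \<in> W \<Longrightarrow> X q = X' q" "\<And>q. q \<in> W \<Longrightarrow> Y q = Y' q"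
  shows "nabla X Y p = nabla X' Y' p"
proof -
  define f where "f q = (if q \<in> W then 1 else 0 :: real)" for q
  have S: "open (coord \<kappa> ` W)" by (rule open_coord_image[OF chart W(1,2)])
  have f1: "f (param \<kappa> x) = 1" if "x \<in> coord \<kappa> ` W" for x using that W(2) by (auto simp: f_def)
  have f: "smooth_fun A W f"
    by (rule smooth_funI[OF W(1,2)], rule smooth_on_cong[OF S smooth_on_const[of _ 1]]) (simp add: f1)
  have pU: "p \<in> U" using W by auto
  have der: "((\<lambda>x. f (param \<kappa> x)) has_derivative (\<lambda>h. 0)) (at (coord \<kappa> p))"
    by (rule has_derivative_transform_within_open[OF has_derivative_const[of 1] S]) (use f1 W in auto)
  have d0: "tderiv A p v f = 0" if "v \<in> tangent_space A p" for v
    using tderiv_chart[OF chart pU that differentiableI[OF der]] dderiv_eqI[OF der] by simp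
  have ff: "(\<lambda>q. f q \<odot> X q) = (\<lambda>q. f q \<odot> X' q)" "(\<lambda>q. f q \<odot> Y q) = (\<lambda>q. f q \<odot> Y' q)"
    using eq by (auto simp: f_def fun_eq_iff)
  have fp: "f p = 1" using W by (simp add: f_def)
  have "nabla X Y p = nabla (\<lambda>q. f q \<odot> X q) Y p"
    using nabla_scale(1)[OF W(1) X(1) Y(1) f W(3)] fp by simp
  also have "\<dots> = nabla X' Y p"
    unfolding ff using nabla_scale(1)[OF W(1) X(2) Y(1) f W(3)] fp by simp
  also have "\<dots> = nabla X' (\<lambda>q. f q \<odot> Y q) p"
    using nabla_scale(2)[OF W(1) X(2) Y(1) f W(3)] fp d0[OF smooth_vfield_tangent[OF X(2) W(3)]] by simp
  also have "\<dots> = nabla X' Y' p"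
    unfolding ff using nabla_scale(2)[OF W(1) X(2) Y(2) f W(3)] fp d0[OF smooth_vfield_tangent[OF X(2) W(3)]] by simp
  finally show ?thesis .
qed

definition Gm :: "real ^ 3 \<Rightarrow> real ^ 3 \<Rightarrow> real ^ 3 \<Rightarrow> real" where
  "Gm x u v = g (param \<kappa> x) (cfield u (param \<kappa> x)) (cfield v (param \<kappa> x))"

definition Chr :: "real ^ 3 \<Rightarrow> real ^ 3 \<Rightarrow> real ^ 3 \<Rightarrow> real ^ 3" where
  "Chr x u v = nabla (cfield u) (cfield v) (param \<kappa> x) \<kappa>"

lemma smooth_component:
  assumes "openin M W" "W \<subseteq> U" "smooth_vfield A W Y"
  shows "smooth_fun A W (\<lambda>q. Y q \<kappa> $ i)"
  by (intro smooth_funI smooth_on_nth open_coord_image chart smooth_coords assms)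

lemma smooth_component_vec:
  assumes W: "openin M W" "W \<subseteq> U" and Y: "smooth_vfield A W Y"
  shows "smooth_vfield A W (\<lambda>q. Y q \<kappa> $ i \<odot> cfield u q)"
proof (rule smooth_vfieldI[OF W])
  show "smooth_on (coord \<kappa> ` W) (\<lambda>x. coords Y x $ i *\<^sub>R u)"
    by (intro smooth_on_scaleR smooth_on_nth smooth_on_const open_coord_image chart smooth_coords W Y)
qed (use W in \<open>auto intro: tangent_add tangent_diff tangent_scale cfield_tangent\<close>)

lemma smooth_vfield_add:
  assumes W: "openin M W" "W \<subseteq> U" and X: "smooth_vfield A W X" and Y: "smooth_vfield A W Y"
  shows "smooth_vfield A W (X + Y)"
proof (rule smooth_vfieldI[OF W])
  show "smooth_on (coord \<kappa> ` W) (\<lambda>x. coords X x + coords Y x)"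
    by (intro smooth_on_add open_coord_image chart smooth_coords W X Y)
qed (use W X Y in \<open>auto intro: tangent_add tangent_diff tangent_scale smooth_vfield_tangent\<close>)

lemma frame_expansion:
  assumes "q \<in> U" "v \<in> tangent_space A q"
  shows "v = (v \<kappa> $ 1 \<odot> cfield (E 1) q) + ((v \<kappa> $ 2 \<odot> cfield (E 2) q) + (v \<kappa> $ 3 \<odot> cfield (E 3) q))"
proof (rule eqI[OF assms])
  show "(v \<kappa> $ 1 \<odot> cfield (E 1) q) + ((v \<kappa> $ 2 \<odot> cfield (E 2) q) + (v \<kappa> $ 3 \<odot> cfield (E 3) q))
      \<in> tangent_space A q"
    by (intro tangent_add tangent_scale cfield_tangent assms)
  show "v \<kappa> = ((v \<kappa> $ 1 \<odot> cfield (E 1) q) + ((v \<kappa> $ 2 \<odot> cfield (E 2) q) + (v \<kappa> $ 3 \<odot> cfield (E 3) q))) \<kappa>"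
    using vec_expansion[of "v \<kappa>"] by (simp add: sum_3 assms add.assoc)
qed

text \<open>Expanding \<open>X\<close> in the coordinate frame: by linearity over functions only its value at \<open>q\<close> matters.\<close>

lemma nabla_pointwise:
  assumes W: "openin M W" "W \<subseteq> U" "q \<in> W" and X: "smooth_vfield A W X" and Y: "smooth_vfield A W Y"
  shows "nabla X Y q = (X q \<kappa> $ 1 \<odot> nabla (cfield (E 1)) Y q) + ((X q \<kappa> $ 2 \<odot> nabla (cfield (E 2)) Y q)
    + (X q \<kappa> $ 3 \<odot> nabla (cfield (E 3)) Y q))"
proof -
  let ?F = "\<lambda>i q. X q \<kappa> $ i \<odot> cfield (E i) q"
  have F: "smooth_vfield A W (?F i)" for i by (rule smooth_component_vec[OF W(1,2) X])
  note add = smooth_vfield_add[OF W(1,2)]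
  have "nabla X Y q = nabla (?F 1 + (?F 2 + ?F 3)) Y q"
  proof (rule nabla_cong[OF W X _ Y Y])
    show "smooth_vfield A W (?F 1 + (?F 2 + ?F 3))" by (intro add F)
    show "X q = (?F 1 + (?F 2 + ?F 3)) q" if "q \<in> W" for q
      using frame_expansion[OF _ smooth_vfield_tangent[OF X that]] that W(2) by auto
  qed simp
  also have "\<dots> = nabla (?F 1) Y q + (nabla (?F 2) Y q + nabla (?F 3) Y q)"
    using nabla_add(1)[OF W(1) F Y add[OF F F] W(3)] nabla_add(1)[OF W(1) F Y F W(3)] by simp
  also have "\<dots> = (X q \<kappa> $ 1 \<odot> nabla (cfield (E 1)) Y q) + ((X q \<kappa> $ 2 \<odot> nabla (cfield (E 2)) Y q)
      + (X q \<kappa> $ 3 \<odot> nabla (cfield (E 3)) Y q))"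
    unfolding nabla_scale(1)[OF W(1) smooth_vec[OF W(1,2)] Y smooth_component[OF W(1,2) X] W(3)] ..
  finally show ?thesis .
qed

lemma tderiv_component:
  assumes W: "openin M W" "W \<subseteq> U" "q \<in> W" and Y: "smooth_vfield A W Y" and v: "v \<in> tangent_space A q"
  shows "tderiv A q v (\<lambda>q. Y q \<kappa> $ i) = dderiv (coords Y) (coord \<kappa> q) (v \<kappa>) $ i"
proof -
  have qU: "q \<in> U" using W by auto
  have "((\<lambda>x. coords Y x $ i) has_derivative (\<lambda>h. dderiv (coords Y) (coord \<kappa> q) h $ i)) (at (coord \<kappa> q))"
    using smooth_on_has_derivative[OF smooth_coords[OF Y W(2)]] W(3)
    by (intro bounded_linear.has_derivative[OF bounded_linear_vec_nth]) auto
  from tderiv_chart[OF chart qU v differentiableI[OF this]] dderiv_eqI[OF this] show ?thesis by metis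
qed

lemma nabla_vec_coords:
  assumes W: "openin M W" "W \<subseteq> U" "q \<in> W" and Y: "smooth_vfield A W Y"
  shows "nabla (cfield u) Y q \<kappa> = dderiv (coords Y) (coord \<kappa> q) u
    + (\<Sum>i\<in>UNIV. Y q \<kappa> $ i *\<^sub>R Chr (coord \<kappa> q) u (E i))"
proof -
  let ?F = "\<lambda>i q. Y q \<kappa> $ i \<odot> cfield (E i) q"
  have qU: "q \<in> U" using W by auto
  have F: "smooth_vfield A W (?F i)" for i by (rule smooth_component_vec[OF W(1,2) Y])
  have u: "smooth_vfield A W (cfield u)" by (rule smooth_vec[OF W(1,2)])
  note add = smooth_vfield_add[OF W(1,2)]
  have "nabla (cfield u) Y q = nabla (cfield u) (?F 1 + (?F 2 + ?F 3)) q"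
  proof (rule nabla_cong[OF W u u Y])
    show "smooth_vfield A W (?F 1 + (?F 2 + ?F 3))" by (intro add F)
    show "Y q = (?F 1 + (?F 2 + ?F 3)) q" if "q \<in> W" for q
      using frame_expansion[OF _ smooth_vfield_tangent[OF Y that]] that W(2) by auto
  qed simp
  also have "\<dots> = nabla (cfield u) (?F 1) q + (nabla (cfield u) (?F 2) q + nabla (cfield u) (?F 3) q)"
    using nabla_add(2)[OF W(1) u F add[OF F F] W(3)] nabla_add(2)[OF W(1) u F F W(3)] by simp
  finally have sum: "nabla (cfield u) Y q \<kappa> = (\<Sum>i\<in>UNIV. nabla (cfield u) (?F i) q \<kappa>)"
    by (simp add: sum_3 add.assoc)
  have "nabla (cfield u) (?F i) q \<kappa> = dderiv (coords Y) (coord \<kappa> q) u $ i *\<^sub>R E i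
      + Y q \<kappa> $ i *\<^sub>R Chr (coord \<kappa> q) u (E i)" for i
    using nabla_scale(2)[OF W(1) u smooth_vec[OF W(1,2)] smooth_component[OF W(1,2) Y] W(3)]
      tderiv_component[OF W Y cfield_tangent[OF qU, of u]] qU by (simp add: Chr_def)
  then show ?thesis
    unfolding sum using vec_expansion[of "dderiv (coords Y) (coord \<kappa> q) u"] by (simp add: sum.distrib)
qed

lemma V_open: "open V"
  by (rule open_coord_image[OF chart U_open order_refl])

lemma in_V: "x \<in> V \<Longrightarrow> param \<kappa> x \<in> U" "x \<in> V \<Longrightarrow> coord \<kappa> (param \<kappa> x) = x"
  using param_image[OF chart order_refl] by auto

lemma dderiv_cfield:
  assumes x: "x \<in> V"
  shows "dderiv (coords (cfield v)) x u = 0"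
  by (intro dderiv_eqI[where f'="\<lambda>_. 0"] has_derivative_transform_within_open[OF has_derivative_const V_open x])
    (auto simp: in_V)

lemma bilinear_Chr:
  assumes x: "x \<in> V"
  shows "bilinear (Chr x)"
proof (rule bilinearI)
  note q = in_V(1)[OF x]
  have right: "Chr x u v = (\<Sum>i\<in>UNIV. v $ i *\<^sub>R Chr x u (E i))" for u v
    using nabla_vec_coords[OF U_open order_refl q smooth_vec[OF U_open order_refl], of u v] q in_V(2)[OF x]
    by (simp add: Chr_def dderiv_cfield[OF x])
  have left: "Chr x u v = (\<Sum>i\<in>UNIV. u $ i *\<^sub>R Chr x (E i) v)" for u v
    using nabla_pointwise[OF U_open order_refl q smooth_vec[OF U_open order_refl] smooth_vec[OF U_open order_refl], of u v] q
    by (simp add: Chr_def sum_3 add.assoc)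
  have lin: "linear (\<lambda>v. \<Sum>i\<in>UNIV. v $ i *\<^sub>R f i)" for f :: "3 \<Rightarrow> real ^ 3"
    by (rule linearI) (simp_all add: algebra_simps sum.distrib scaleR_sum_right)
  have "Chr x u = (\<lambda>v. \<Sum>i\<in>UNIV. v $ i *\<^sub>R Chr x u (E i))" for u using right by blast
  then show "linear (Chr x u)" for u using lin[of "\<lambda>i. Chr x u (E i)"] by metis
  have "(\<lambda>u. Chr x u v) = (\<lambda>u. \<Sum>i\<in>UNIV. u $ i *\<^sub>R Chr x (E i) v)" for v using left by blast
  then show "linear (\<lambda>u. Chr x u v)" for v using lin[of "\<lambda>i. Chr x (E i) v"] by metis
qed

text \<open>The connection in a chart: expanding both arguments in the coordinate frame, the Leibniz rule
  produces the derivative of the coefficients, and linearity leaves the Christoffel symbols.\<close>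

lemma nabla_coords:
  assumes W: "openin M W" "W \<subseteq> U" "q \<in> W" and X: "smooth_vfield A W X" and Y: "smooth_vfield A W Y"
  shows "nabla X Y q \<kappa> = dderiv (coords Y) (coord \<kappa> q) (X q \<kappa>) + Chr (coord \<kappa> q) (X q \<kappa>) (Y q \<kappa>)"
proof -
  have qU: "q \<in> U" using W by auto
  have bil: "bilinear (Chr (coord \<kappa> q))" using bilinear_Chr qU by simp
  have "nabla X Y q = nabla (cfield (X q \<kappa>)) Y q"
    using nabla_pointwise[OF W X Y] nabla_pointwise[OF W smooth_vec[OF W(1,2)] Y, of "X q \<kappa>"] qU by simp
  then show ?thesis
    using nabla_vec_coords[OF W Y, of "X q \<kappa>"] linear_expansion[OF bilinearD(1)[OF bil], of "X q \<kappa>" "Y q \<kappa>"]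
    by simp
qed

lemma smooth_Chr: "smooth_on V (\<lambda>x. Chr x u v)"
  unfolding Chr_def
  by (intro smooth_coords nabla_smooth smooth_vec U_open order_refl)

lemma g_coords:
  assumes "q \<in> U" "u \<in> tangent_space A q" "v \<in> tangent_space A q"
  shows "g q u v = Gm (coord \<kappa> q) (u \<kappa>) (v \<kappa>)"
  using assms by (simp add: Gm_def cfield_coords)

lemma inner_product_Gm:
  assumes x: "x \<in> V"
  shows "inner_product3 (Gm x)"
proof -
  define q where "q = param \<kappa> x"
  have q: "q \<in> U" using in_V(1)[OF x] by (simp add: q_def)
  have top: "q \<in> topspace M" by (rule dom_subset_topspace[OF chart q])
  have R: "g q u v = g q v u \<and> (u \<noteq> 0 \<longrightarrow> g q u u > 0) \<and>
      (\<forall>w \<in> tangent_space A q. g q (u + v) w = g q u w + g q v w) \<and> (\<forall>c. g q (c \<odot> u) v = c * g q u v)"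
    if "u \<in> tangent_space A q" "v \<in> tangent_space A q" for u v
    using riemannian top that unfolding riemannian_metric_def by blast
  note t = cfield_tangent[OF q]
  have sym: "Gm x u v = Gm x v u" for u v
    unfolding Gm_def q_def[symmetric] using R[OF t t] by blast
  have lin: "linear (\<lambda>u. Gm x u v)" for v
    unfolding Gm_def q_def[symmetric]
    by (rule linearI) (use R[OF t t] t in \<open>auto simp: cfield_add[OF q] cfield_scale[OF q]\<close>)
  show ?thesis
  proof
    have "linear (Gm x u)" for u
      by (rule linearI) (simp_all add: sym[of u] linear_add[OF lin] linear_cmul[OF lin])
    then show "bilinear (Gm x)" using lin by (rule bilinearI)
    show "Gm x u v = Gm x v u" for u v by (rule sym)
    show "Gm x u u > 0" if "u \<noteq> 0" for u
    proof -
      have "cfield u q \<noteq> 0" using cfield_apply[OF q, of u] that by auto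
      then show ?thesis unfolding Gm_def q_def[symmetric] using R[OF t t] by blast
    qed
  qed
qed

lemma smooth_Gm: "smooth_on V (\<lambda>x. Gm x u v)"
proof -
  have "smooth_fun A U (\<lambda>p. g p (cfield u p) (cfield v p))"
    by (rule riemannian[unfolded riemannian_metric_def, THEN conjunct2, rule_format])
      (simp add: U_open smooth_vec)
  then show ?thesis using chart by (auto simp: smooth_fun_def o_def Gm_def)
qed

lemma torsion:
  assumes "openin M W" "smooth_vfield A W X" "smooth_vfield A W Y" "p \<in> W"
  shows "nabla X Y p - nabla Y X p = lie_bracket A X Y p"
  by (rule levi_civita[unfolded levi_civita_def, THEN conjunct2, THEN conjunct1, rule_format, OF conjI])
    (use assms in auto)

lemma metric_compatible:
  assumes "openin M W" "smooth_vfield A W X" "smooth_vfield A W Y" "smooth_vfield A W Z" "p \<in> W"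
  shows "tderiv A p (X p) (\<lambda>q. g q (Y q) (Z q)) = g p (nabla X Y p) (Z p) + g p (Y p) (nabla X Z p)"
  by (rule levi_civita[unfolded levi_civita_def, THEN conjunct2, THEN conjunct2, rule_format, OF conjI])
    (use assms in auto)

sublocale coordinate_geometry V Gm Chr
proof (rule coordinate_geometry.intro)
  fix x u v w assume x: "x \<in> V"
  define q where "q = param \<kappa> x"
  have q: "q \<in> U" "coord \<kappa> q = x" using in_V[OF x] by (auto simp: q_def)
  note s = smooth_vec[OF U_open order_refl]
  have "Chr x u v - Chr x v u = lie_bracket A (cfield u) (cfield v) q \<kappa>"
    using fun_cong[OF torsion[OF U_open s s q(1), of u v], of \<kappa>] by (simp add: Chr_def q_def)
  also have "\<dots> = 0" using q chart x by (simp add: lie_bracket_def dderiv_cfield)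
  finally show "Chr x u v = Chr x v u" by simp
  have n: "nabla (cfield u) (cfield v) q \<in> tangent_space A q" for u v
    by (rule smooth_vfield_tangent[OF nabla_smooth[OF U_open s s] q(1)])
  have "dderiv (\<lambda>y. Gm y u v) x w = tderiv A q (cfield w q) (\<lambda>q. g q (cfield u q) (cfield v q))"
    using tderiv_chart[OF chart q(1) cfield_tangent[OF q(1)], of "\<lambda>q. g q (cfield u q) (cfield v q)" w]
      smooth_on_differentiable[OF smooth_Gm x, of u v] q by (simp add: Gm_def)
  also have "\<dots> = g q (nabla (cfield w) (cfield u) q) (cfield v q) + g q (cfield u q) (nabla (cfield w) (cfield v) q)"
    by (rule metric_compatible[OF U_open s s s q(1)])
  also have "\<dots> = Gm x (Chr x w u) v + Gm x u (Chr x w v)"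
    using g_coords[OF q(1) n cfield_tangent[OF q(1)]] g_coords[OF q(1) cfield_tangent[OF q(1)] n] q
    by (simp add: Chr_def q_def[symmetric])
  finally show "dderiv (\<lambda>y. Gm y u v) x w = Gm x (Chr x w u) v + Gm x u (Chr x w v)" .
qed (auto intro: V_open inner_product_Gm smooth_Gm bilinear_Chr smooth_Chr)

end


section \<open>Curvature and Cotton tensor in a chart\<close>

context riemannian_chart
begin

lemma U_topspace: "q \<in> U \<Longrightarrow> q \<in> topspace M"
  by (rule dom_subset_topspace[OF chart])

lemma image_open: "openin M W \<Longrightarrow> W \<subseteq> U \<Longrightarrow> open (coord \<kappa> ` W)"
  by (rule open_coord_image[OF chart])

lemma coords_nabla:
  assumes W: "openin M W" "W \<subseteq> U" and X: "smooth_vfield A W X" and Y: "smooth_vfield A W Y"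
    and x: "x \<in> coord \<kappa> ` W"
  shows "coords (nabla X Y) x = cov (coords X) (coords Y) x"
  using nabla_coords[OF W _ X Y] x W(2) by (auto simp: cov_def)

lemma nabla_tangent:
  assumes "openin M W" "smooth_vfield A W X" "smooth_vfield A W Y" "q \<in> W"
  shows "nabla X Y q \<in> tangent_space A q"
  by (rule smooth_vfield_tangent[OF nabla_smooth[OF assms(1-3)] assms(4)])

lemma lie_bracket_coords:
  assumes "q \<in> U"
  shows "lie_bracket A X Y q \<kappa> = dderiv (coords Y) (coord \<kappa> q) (X q \<kappa>) - dderiv (coords X) (coord \<kappa> q) (Y q \<kappa>)"
  using assms chart by (simp add: lie_bracket_def)

text \<open>The connection is torsion free, so the bracket is a difference of covariant derivatives.\<close>

lemma smooth_lie_bracket: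
  assumes W: "openin M W" "W \<subseteq> U" and X: "smooth_vfield A W X" and Y: "smooth_vfield A W Y"
  shows "smooth_vfield A W (lie_bracket A X Y)"
proof (rule smooth_vfieldI[OF W])
  show "smooth_on (coord \<kappa> ` W) (\<lambda>x. coords (nabla X Y) x - coords (nabla Y X) x)"
    by (intro smooth_on_diff image_open W smooth_coords nabla_smooth X Y)
  fix q assume q: "q \<in> W"
  have eq: "lie_bracket A X Y q = nabla X Y q - nabla Y X q"
    by (rule torsion[OF W(1) X Y q, symmetric])
  show "lie_bracket A X Y q \<in> tangent_space A q"
    unfolding eq by (intro tangent_diff nabla_tangent[OF W(1) _ _ q] X Y)
  show "lie_bracket A X Y q \<kappa> = coords (nabla X Y) (coord \<kappa> q) - coords (nabla Y X) (coord \<kappa> q)"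
    unfolding eq using q W(2) by auto
qed

lemma curvature_coords:
  assumes W: "openin M W" "W \<subseteq> U" "q \<in> W"
    and X: "smooth_vfield A W X" and Y: "smooth_vfield A W Y" and Z: "smooth_vfield A W Z"
  shows "curvature A nabla X Y Z q \<kappa> = Riem (coord \<kappa> q) (X q \<kappa>) (Y q \<kappa>) (Z q \<kappa>)"
    and "curvature A nabla X Y Z q \<in> tangent_space A q"
proof -
  let ?x = "coord \<kappa> q"
  have q: "q \<in> U" using W by auto
  have S: "open (coord \<kappa> ` W)" "coord \<kappa> ` W \<subseteq> V" "?x \<in> coord \<kappa> ` W" using image_open W by auto
  note lie = smooth_lie_bracket[OF W(1,2) X Y]
  have two: "nabla A1 (nabla A2 Z) q \<kappa> = cov (coords A1) (cov (coords A2) (coords Z)) ?x"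
    if "smooth_vfield A W A1" "smooth_vfield A W A2" for A1 A2
  proof -
    have "nabla A1 (nabla A2 Z) q \<kappa> = cov (coords A1) (coords (nabla A2 Z)) ?x"
      using coords_nabla[OF W(1,2) that(1) nabla_smooth[OF W(1) that(2) Z] S(3)] q by simp
    also have "\<dots> = cov (coords A1) (cov (coords A2) (coords Z)) ?x"
      by (rule cov_cong[OF S(1,3) coords_nabla[OF W(1,2) that(2) Z]])
    finally show ?thesis .
  qed
  have "nabla (lie_bracket A X Y) Z q \<kappa>
      = cov (\<lambda>y. dderiv (coords Y) y (coords X y) - dderiv (coords X) y (coords Y y)) (coords Z) ?x"
    using nabla_coords[OF W lie Z] q by (simp add: cov_def lie_bracket_coords[OF q])
  then show "curvature A nabla X Y Z q \<kappa> = Riem ?x (X q \<kappa>) (Y q \<kappa>) (Z q \<kappa>)"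
    using curvature_tensorial[OF S smooth_coords[OF X W(2)] smooth_coords[OF Y W(2)] smooth_coords[OF Z W(2)]]
      two[OF X Y] two[OF Y X] q by (simp add: curvature_def)
  have "curvature A nabla X Y Z q
      = nabla X (nabla Y Z) q - nabla Y (nabla X Z) q - nabla (lie_bracket A X Y) Z q"
    by (simp add: curvature_def)
  then show "curvature A nabla X Y Z q \<in> tangent_space A q"
    by (simp only:)
      (intro tangent_diff nabla_tangent[OF W(1) _ _ W(3)] nabla_smooth[OF W(1)] X Y Z lie)
qed

text \<open>The extensions of tangent vectors at \<open>q\<close> have constant coefficients in a chart chosen for \<open>q\<close>,
  which need not be the present one, so they are only compared on the overlap of the two.\<close>

definition overlap :: "'a \<Rightarrow> 'a set" where
  "overlap q = U \<inter> dom_ch (chart_at A q)"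

lemma overlap:
  assumes "q \<in> U"
  shows "openin M (overlap q)" "overlap q \<subseteq> U" "q \<in> overlap q" "smooth_vfield A (overlap q) (ext A q v)"
proof -
  note c = chart_at[OF U_topspace[OF assms]]
  show o: "openin M (overlap q)" unfolding overlap_def by (intro openin_Int U_open dom_open c)
  show "overlap q \<subseteq> U" "q \<in> overlap q" using assms c by (auto simp: overlap_def)
  show "smooth_vfield A (overlap q) (ext A q v)"
    by (rule smooth_ext[OF U_topspace[OF assms] o]) (auto simp: overlap_def)
qed

lemma ext_apply: "q \<in> U \<Longrightarrow> v \<in> tangent_space A q \<Longrightarrow> ext A q v q = v"
  by (rule ext_at[OF U_topspace])

lemma ricci_coords:
  assumes q: "q \<in> U" and u: "u \<in> tangent_space A q" and v: "v \<in> tangent_space A q"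
  shows "ricci A nabla q u v = Ric (coord \<kappa> q) (u \<kappa>) (v \<kappa>)"
  unfolding ricci_def Ric_def
proof (rule tangent_trace_chart[OF chart q])
  note o = overlap[OF q]
  show "curvature A nabla (ext A q x) (ext A q u) (ext A q v) q \<in> tangent_space A q" for x
    by (rule curvature_coords(2)[OF o(1-3) o(4) o(4) o(4)])
  show "curvature A nabla (ext A q x) (ext A q u) (ext A q v) q \<kappa> = Riem (coord \<kappa> q) (x \<kappa>) (u \<kappa>) (v \<kappa>)"
    if "x \<in> tangent_space A q" for x
    using curvature_coords(1)[OF o(1-3) o(4) o(4) o(4), of x u v] that u v by (simp add: ext_apply q)
  show "linear (\<lambda>x. Riem (coord \<kappa> q) x (u \<kappa>) (v \<kappa>))" using linear_Riem(1) q by blast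
qed

text \<open>Positive definiteness makes the vector representing a linear form unique, so any \<open>w\<close> with the right
inner products gives the value of the description operator.\<close>

lemma endo_of_coords:
  assumes q: "q \<in> U" and B: "\<And>v. v \<in> tangent_space A q \<Longrightarrow> B q u v = Gm (coord \<kappa> q) w (v \<kappa>)"
  shows "endo_of A g B q u = cfield w q"
  unfolding endo_of_def
proof (rule the_equality)
  have x: "coord \<kappa> q \<in> V" using q by auto
  note t = cfield_tangent[OF q]
  show "cfield w q \<in> tangent_space A q \<and> (\<forall>v \<in> tangent_space A q. g q (cfield w q) v = B q u v)"
    using t B q by (simp add: g_coords)
  fix w' assume w': "w' \<in> tangent_space A q \<and> (\<forall>v \<in> tangent_space A q. g q w' v = B q u v)"
  have "w' \<kappa> = w"
  proof (rule inner_product3.eqI[OF inner_product_Gm[OF x]])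
    fix a
    have "g q w' (cfield a q) = B q u (cfield a q)" using w' t by blast
    then show "Gm (coord \<kappa> q) (w' \<kappa>) a = Gm (coord \<kappa> q) w a"
      using g_coords[OF q conjunct1[OF w'] t] B[OF t] q by simp
  qed
  then show "w' = cfield w q" using cfield_coords[OF q] w' by auto
qed

lemma scal_coords:
  assumes q: "q \<in> U"
  shows "scal A g nabla q = Scal (coord \<kappa> q)"
proof -
  have x: "coord \<kappa> q \<in> V" using q by auto
  have e: "endo_of A g (ricci A nabla) q u = cfield (Ric_endo (coord \<kappa> q) (u \<kappa>)) q"
    if "u \<in> tangent_space A q" for u
    by (rule endo_of_coords[OF q]) (simp add: ricci_coords[OF q that] Ric_endo[OF x])
  show ?thesis
    unfolding scal_def Scal_def
    by (rule tangent_trace_chart[OF chart q]) (auto simp: e q cfield_tangent linear_Ric_endo[OF x])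
qed

lemma schouten_endo_coords:
  assumes q: "q \<in> U" and u: "u \<in> tangent_space A q"
  shows "schouten_endo A g nabla q u = cfield (Sch_endo (coord \<kappa> q) (u \<kappa>)) q"
proof -
  have x: "coord \<kappa> q \<in> V" using q by auto
  show ?thesis
    unfolding schouten_endo_def
    by (rule endo_of_coords[OF q])
      (simp add: Sch_endo[OF x] Sch_def schouten_def ricci_coords[OF q u] scal_coords[OF q] g_coords[OF q u])
qed

lemma cotton_form_coords:
  assumes q: "q \<in> U" and u: "u \<in> tangent_space A q" and v: "v \<in> tangent_space A q"
  shows "cotton_form A g nabla q u v \<in> tangent_space A q"
    and "cotton_form A g nabla q u v \<kappa> = Cott_form (coord \<kappa> q) (u \<kappa>) (v \<kappa>)"
proof -
  let ?x = "coord \<kappa> q" and ?P = "schouten_endo A g nabla"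
  define X Y W where "X = ext A q u" and "Y = ext A q v" and "W = overlap q"
  note W = overlap(1-3)[OF q, folded W_def]
  have X: "smooth_vfield A W X" "X q = u" and Y: "smooth_vfield A W Y" "Y q = v"
    using overlap(4)[OF q] ext_apply[OF q] u v by (auto simp: X_def Y_def W_def)
  have S: "open (coord \<kappa> ` W)" "coord \<kappa> ` W \<subseteq> V" "?x \<in> coord \<kappa> ` W" using image_open W by auto
  have PZ: "coords (\<lambda>r. ?P r (Z r)) x = Sch_endo x (coords Z x)"
    if Z: "smooth_vfield A W Z" and x: "x \<in> coord \<kappa> ` W" for Z x
  proof -
    obtain r where r: "r \<in> W" "r \<in> U" "x = coord \<kappa> r" using x W(2) by auto
    then show ?thesis
      using schouten_endo_coords[OF r(2) smooth_vfield_tangent[OF Z r(1)]] by simp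
  qed
  have P: "smooth_vfield A W (\<lambda>r. ?P r (Z r))" if Z: "smooth_vfield A W Z" for Z
  proof (rule smooth_vfieldI[OF W(1,2)])
    show "smooth_on (coord \<kappa> ` W) (\<lambda>x. Sch_endo x (coords Z x))"
    proof (rule smooth_on_linear_field[OF S(1), where L=Sch_endo])
      show "linear (Sch_endo y)" if "y \<in> coord \<kappa> ` W" for y
        by (rule linear_Sch_endo) (use that S(2) in blast)
    qed (intro smooth_on_subset[OF smooth_Sch_endo S(2)] smooth_coords[OF Z W(2)])+
    show "?P r (Z r) \<in> tangent_space A r" if "r \<in> W" for r
      using schouten_endo_coords smooth_vfield_tangent[OF Z that] cfield_tangent that W(2) by fastforce
    show "?P r (Z r) \<kappa> = Sch_endo (coord \<kappa> r) (coords Z (coord \<kappa> r))" if "r \<in> W" for r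
      using PZ[OF Z, of "coord \<kappa> r"] that W(2) by auto
  qed
  have c: "?P q (nabla Z1 Z2 q) \<in> tangent_space A q"
      "?P q (nabla Z1 Z2 q) \<kappa> = Sch_endo ?x (cov (coords Z1) (coords Z2) ?x)"
    if "smooth_vfield A W Z1" "smooth_vfield A W Z2" for Z1 Z2
    using schouten_endo_coords[OF q nabla_tangent[OF W(1) that W(3)]] cfield_tangent[OF q]
      coords_nabla[OF W(1,2) that S(3)] q by simp_all
  have d: "nabla Z1 (\<lambda>r. ?P r (Z2 r)) q \<kappa> = cov (coords Z1) (\<lambda>y. Sch_endo y (coords Z2 y)) ?x"
    if "smooth_vfield A W Z1" "smooth_vfield A W Z2" for Z1 Z2
    using coords_nabla[OF W(1,2) that(1) P[OF that(2)] S(3)] cov_cong[OF S(1,3) PZ[OF that(2)]] q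
    by simp
  have form: "cotton_form A g nabla q u v = (nabla X (\<lambda>r. ?P r (Y r)) q - ?P q (nabla X Y q))
      - (nabla Y (\<lambda>r. ?P r (X r)) q - ?P q (nabla Y X q))"
    unfolding cotton_form_def ext_covd_def covd_endo_def X_def Y_def minus_apply ..
  show "cotton_form A g nabla q u v \<in> tangent_space A q"
    unfolding form by (intro tangent_diff nabla_tangent[OF W(1) _ _ W(3)] P c(1) X(1) Y(1))
  show "cotton_form A g nabla q u v \<kappa> = Cott_form ?x (u \<kappa>) (v \<kappa>)"
    using Cott_form_tensorial[OF S smooth_coords[OF X(1) W(2)] smooth_coords[OF Y(1) W(2)]]
    unfolding form minus_apply c(2)[OF X(1) Y(1)] c(2)[OF Y(1) X(1)] d[OF X(1) Y(1)] d[OF Y(1) X(1)]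
    by (simp add: q X(2) Y(2))
qed

lemma orthonormal_coords:
  assumes "q \<in> U" "orthonormal_basis_at A g q S"
  shows "inner_product3.orthonormal (Gm (coord \<kappa> q)) (\<lambda>i. S i \<kappa>)"
proof -
  have "coord \<kappa> q \<in> V" using assms(1) by auto
  then interpret inner_product3 "Gm (coord \<kappa> q)" by (rule inner_product_Gm)
  have t: "S i \<in> tangent_space A q" for i using assms(2) by (simp add: orthonormal_basis_at_def)
  show ?thesis
    using assms(2) by (simp add: orthonormal_def orthonormal_basis_at_def g_coords[OF assms(1) t t])
qed

text \<open>An oriented orthonormal basis in the coordinates of one chart is positively oriented in every other
chart around \<open>q\<close>, as all Jacobians have positive determinant.\<close>

lemma ex_oriented_orthonormal:
  assumes q: "q \<in> U"
  shows "\<exists>S. orthonormal_basis_at A g q S \<and> positively_oriented_at A q S"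
proof -
  have x: "coord \<kappa> q \<in> V" using q by auto
  interpret inner_product3 "Gm (coord \<kappa> q)" by (rule inner_product_Gm[OF x])
  obtain s where s: "orthonormal s" "det (\<chi> i. s i) > 0" using ex_orthonormal by blast
  have "orthonormal_basis_at A g q (\<lambda>i. cfield (s i) q)"
    using s(1) q by (simp add: orthonormal_basis_at_def cfield_tangent g_coords orthonormal_def)
  moreover have "det (\<chi> i. cfield (s i) q \<kappa>') > 0" if \<kappa>': "\<kappa>' \<in> A" "q \<in> dom_ch \<kappa>'" for \<kappa>'
  proof -
    have lin: "linear (jac \<kappa> \<kappa>' q)" by (rule linear_jac[OF chart \<kappa>'(1) q \<kappa>'(2)])
    have "(\<chi> i. cfield (s i) q \<kappa>') = (\<chi> i. s i) ** transpose (matrix (jac \<kappa> \<kappa>' q))"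
    proof -
      have "cfield (s i) q \<kappa>' $ j = (\<Sum>k\<in>UNIV. s i $ k * matrix (jac \<kappa> \<kappa>' q) $ j $ k)" for i j
        using \<kappa>' linear_expansion[OF lin, of "s i"] by (simp add: cfield_def tvec_of_def matrix_def)
      then show ?thesis by (simp add: vec_eq_iff matrix_matrix_mult_def transpose_def)
    qed
    moreover have "det (matrix (jac \<kappa> \<kappa>' q)) > 0"
      using manifold chart \<kappa>' q unfolding oriented_smooth_3manifold_def by blast
    ultimately show ?thesis using s(2) by (simp add: det_mul)
  qed
  ultimately show ?thesis unfolding positively_oriented_at_def by blast
qed

lemma sum_tangent:
  fixes f :: "3 \<Rightarrow> 'a tvec"
  shows "(\<And>i. f i \<in> tangent_space A q) \<Longrightarrow> (\<Sum>i\<in>UNIV. f i) \<in> tangent_space A q"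
  unfolding sum_3 by (intro tangent_add)

text \<open>The Hodge star is defined by an unspecified choice of basis at every point; the choice disappears
from the coordinate expression, which makes \<open>cotton\<close> differentiable.\<close>

lemma cotton_coords:
  assumes q: "q \<in> U" and u: "u \<in> tangent_space A q" and v: "v \<in> tangent_space A q"
  shows "cotton A g nabla q u v = Cott (coord \<kappa> q) (u \<kappa>) (v \<kappa>)"
proof -
  let ?x = "coord \<kappa> q" and ?\<beta> = "cotton_form A g nabla q"
  have x: "?x \<in> V" using q by auto
  interpret inner_product3 "Gm ?x" by (rule inner_product_Gm[OF x])
  define S where "S = (SOME S. orthonormal_basis_at A g q S \<and> positively_oriented_at A q S)"
  have S: "orthonormal_basis_at A g q S" "positively_oriented_at A q S"
    using someI_ex[OF ex_oriented_orthonormal[OF q]] by (auto simp: S_def)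
  have t: "S i \<in> tangent_space A q" for i using S(1) by (simp add: orthonormal_basis_at_def)
  define H where "H = (\<Sum>i\<in>UNIV. g q u (S i) \<odot> ?\<beta> (S (i + 1)) (S (i + 2)))"
  have H: "H \<in> tangent_space A q"
    unfolding H_def by (intro sum_tangent tangent_scale cotton_form_coords(1) q t)
  have "H \<kappa> = (\<Sum>i\<in>UNIV. Gm ?x (u \<kappa>) (S i \<kappa>) *\<^sub>R Cott_form ?x (S (i + 1) \<kappa>) (S (i + 2) \<kappa>))"
    by (simp add: H_def sum_3 g_coords[OF q u t] cotton_form_coords(2)[OF q t t])
  also have "\<dots> = (1 / sqrt (det gram)) *\<^sub>R (\<Sum>c\<in>UNIV. Gm ?x (u \<kappa>) (E c) *\<^sub>R Cott_form ?x (E (c + 1)) (E (c + 2)))"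
    by (rule hodge_standard_basis[OF orthonormal_coords[OF q S(1)] _ bilinear_Cott_form[OF x] Cott_form_antisym])
      (use S(2) chart q in \<open>simp add: positively_oriented_at_def\<close>)
  finally have "Gm ?x (H \<kappa>) (v \<kappa>) = Cott ?x (u \<kappa>) (v \<kappa>)"
    by (simp add: Cott_def scale_left sum_left)
  then show ?thesis
    unfolding cotton_def hodge_star_def Let_def S_def[symmetric] H_def[symmetric]
    by (simp add: g_coords[OF q H v])
qed

text \<open>For the chart chosen at \<open>p\<close> itself, the extensions of tangent vectors at \<open>p\<close> are the constant fields
of the chart, and the divergence is literally the expression in \<open>divergence_Cott\<close>.\<close>

lemma codiff_cotton:
  assumes p: "p \<in> U" and \<kappa>: "chart_at A p = \<kappa>" and z: "z \<in> tangent_space A p"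
  shows "codiff A g nabla (cotton A g nabla) p z = 0"
proof -
  let ?x = "coord \<kappa> p"
  have x: "?x \<in> V" using p by auto
  define S where "S = (SOME S. orthonormal_basis_at A g p S)"
  have "\<exists>S. orthonormal_basis_at A g p S" using ex_oriented_orthonormal[OF p] by blast
  then have S: "orthonormal_basis_at A g p S" unfolding S_def by (rule someI_ex)
  have t: "S i \<in> tangent_space A p" for i using S by (simp add: orthonormal_basis_at_def)
  have ext: "ext A p v = cfield (v \<kappa>)" for v by (simp add: ext_def cfield_def \<kappa>)
  note s = smooth_vec[OF U_open order_refl]
  have n: "nabla (cfield a) (cfield b) p \<in> tangent_space A p" "nabla (cfield a) (cfield b) p \<kappa> = Chr ?x a b" for a b
    using nabla_tangent[OF U_open s s p] p by (auto simp: Chr_def)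
  have cov: "covd_bilin A nabla (cotton A g nabla) (cfield a) (cfield b) (cfield c) p
      = dderiv (\<lambda>y. Cott y b c) ?x a - Cott ?x (Chr ?x a b) c - Cott ?x b (Chr ?x a c)" for a b c
  proof -
    have eq: "cotton A g nabla (param \<kappa> y) (cfield b (param \<kappa> y)) (cfield c (param \<kappa> y)) = Cott y b c"
      if "y \<in> V" for y
      using in_V[OF that] by (simp add: cotton_coords cfield_tangent)
    have "tderiv A p (cfield a p) (\<lambda>q. cotton A g nabla q (cfield b q) (cfield c q))
        = dderiv (\<lambda>y. cotton A g nabla (param \<kappa> y) (cfield b (param \<kappa> y)) (cfield c (param \<kappa> y))) ?x a"
      using tderiv_chart[OF chart p cfield_tangent[OF p], of "\<lambda>q. cotton A g nabla q (cfield b q) (cfield c q)" a]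
        differentiable_cong_open[OF differentiable_Cott[OF x] V_open x eq[symmetric]] p by simp
    also have "\<dots> = dderiv (\<lambda>y. Cott y b c) ?x a"
      by (rule fun_cong[OF dderiv_cong_open[OF V_open x eq]])
    finally show ?thesis
      by (simp add: covd_bilin_def cotton_coords[OF p] n cfield_tangent[OF p] p)
  qed
  show ?thesis
    using divergence_Cott[OF x orthonormal_coords[OF p S], of "z \<kappa>"]
    unfolding codiff_def Let_def S_def[symmetric] by (simp add: ext cov)
qed

end

theorem proposition14:
  fixes M :: "'a topology" and A :: "'a chart set" and g :: "'a bilin" and nabla :: "'a conn"
  assumes "oriented_smooth_3manifold M A"
    and "riemannian_metric M A g"
    and "levi_civita M A g nabla"
  shows "\<forall>p \<in> topspace M. \<forall>z \<in> tangent_space A p.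
           codiff A g nabla (cotton A g nabla) p z = 0"
proof (intro ballI)
  fix p z assume p: "p \<in> topspace M" and z: "z \<in> tangent_space A p"
  have atlas: "smooth_atlas3 M A" using assms(1) by (rule smooth_atlas3.intro)
  note c = smooth_atlas3.chart_at[OF atlas p]
  interpret riemannian_chart M A g nabla "chart_at A p"
    by (intro riemannian_chart.intro riemannian_chart_axioms.intro atlas assms(2,3) c(1))
  show "codiff A g nabla (cotton A g nabla) p z = 0"
    by (rule codiff_cotton[OF c(2) refl z])
qed

end
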